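(* Let $R$ be a unital associative ring and let $\mathcal{C}$ be the category of inverse sequences of left $R$-modules. For any inverse sequence $(X_n)_n$ in $\mathcal{C}$ there is an inverse sequence $(A_n)_n$ in $\mathcal{C}$ and a morphism of inverse sequences $f : (A_n)_n \longrightarrow (X_n)_n$, which depends functorially on $(X_n)_n$, such that: (i) the inverse sequence $(A_n)_n$ represents a decreasing filtration of $A = A_0$ by submodules, (ii) the modules $A_n$ are free for all $n$, (iii) the successive quotients $A_n/A_{n+1}$ are free modules for all $n$, and (iv) $f$ induces an isomorphism $\lim^1_n A_n \stackrel{\sim}{\longrightarrow} \lim^1_n X_n$.
   Context: All modules are left modules over a fixed unital associative ring $R$. An inverse sequence of modules $X=(X_n)_n$ consists of modules $X_n$, $n \geq 0$, and linear structure maps $s_n : X_n \longrightarrow X_{n-1}$, $n\geq 1$. Inverse sequences form an abelian category $\mathcal{C}$ (contravariant functors from the ordered set $\omega$ to $R$-modules); morphisms are families of linear maps commuting with the structure maps. For $X \in \mathcal{C}$, let $1-S : \prod_n X_n \longrightarrow \prod_n X_n$ be the map $(x_n)_n \mapsto (x_n - s_{n+1}(x_{n+1}))_n$. Then $\lim_n X_n = \ker(1-S)$ and $\lim^1_n X_n = \mathrm{coker}(1-S)$. An inverse sequence $(A_n)_n$ represents a decreasing filtration of $A_0$ by submodules if all its structure maps $A_n \longrightarrow A_{n-1}$ are injective, so that $A_n$ is identified with a submodule of $A_{n-1}$ (and of $A_0$); the quotient $A_n/A_{n+1}$ is then the cokernel of the structure map $A_{n+1} \longrightarrow A_n$. "Depends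 functorially on $(X_n)_n$" means that there is a functor $\mathcal{C} \longrightarrow \mathcal{C}$, $X \mapsto A$, such that the morphisms $f: A \longrightarrow X$ form a natural transformation to the identity functor of $\mathcal{C}$. *)

theory Defs
  imports "HOL-Algebra.Module" "HOL-Algebra.AbelCoset"
begin

section \<open>Left modules over a ring\<close>

text \<open>The library locale \<^locale>\<open>module\<close> demands a commutative ring of scalars; here the ring is
  arbitrary. The ring multiplication and unit contained in the record type of modules carry no
  meaning.\<close>

locale left_module = R?: ring R + M?: abelian_group M
  for R :: "('r, 'k) ring_scheme" (structure) and M :: "('r, 'a, 'm) module_scheme" (structure) +
  assumes smult_closed: "\<lbrakk>a \<in> carrier R; x \<in> carrier M\<rbrakk> \<Longrightarrow> a \<odot>\<^bsub>M\<^esub> x \<in> carrier M"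
    and smult_l_distr: "\<lbrakk>a \<in> carrier R; b \<in> carrier R; x \<in> carrier M\<rbrakk> \<Longrightarrow>
      (a \<oplus>\<^bsub>R\<^esub> b) \<odot>\<^bsub>M\<^esub> x = a \<odot>\<^bsub>M\<^esub> x \<oplus>\<^bsub>M\<^esub> b \<odot>\<^bsub>M\<^esub> x"
    and smult_r_distr: "\<lbrakk>a \<in> carrier R; x \<in> carrier M; y \<in> carrier M\<rbrakk> \<Longrightarrow>
      a \<odot>\<^bsub>M\<^esub> (x \<oplus>\<^bsub>M\<^esub> y) = a \<odot>\<^bsub>M\<^esub> x \<oplus>\<^bsub>M\<^esub> a \<odot>\<^bsub>M\<^esub> y"
    and smult_assoc: "\<lbrakk>a \<in> carrier R; b \<in> carrier R; x \<in> carrier M\<rbrakk> \<Longrightarrow>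
      (a \<otimes>\<^bsub>R\<^esub> b) \<odot>\<^bsub>M\<^esub> x = a \<odot>\<^bsub>M\<^esub> (b \<odot>\<^bsub>M\<^esub> x)"
    and smult_one: "x \<in> carrier M \<Longrightarrow> \<one>\<^bsub>R\<^esub> \<odot>\<^bsub>M\<^esub> x = x"

text \<open>Morphisms are required to be extensional (constantly \<^const>\<open>undefined\<close> off the carrier), so
  that they are equal as terms iff they are equal as maps.\<close>

definition linear_maps ::
  "('r, 'k) ring_scheme \<Rightarrow> ('r, 'a) module \<Rightarrow> ('r, 'b) module \<Rightarrow> ('a \<Rightarrow> 'b) set" where
  "linear_maps R M N = {h \<in> carrier M \<rightarrow>\<^sub>E carrier N.
     (\<forall>x\<in>carrier M. \<forall>y\<in>carrier M. h (x \<oplus>\<^bsub>M\<^esub> y) = h x \<oplus>\<^bsub>N\<^esub> h y) \<and>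
     (\<forall>a\<in>carrier R. \<forall>x\<in>carrier M. h (a \<odot>\<^bsub>M\<^esub> x) = a \<odot>\<^bsub>N\<^esub> h x)}"

definition linear_isos ::
  "('r, 'k) ring_scheme \<Rightarrow> ('r, 'a) module \<Rightarrow> ('r, 'b) module \<Rightarrow> ('a \<Rightarrow> 'b) set" where
  "linear_isos R M N = {h \<in> linear_maps R M N. bij_betw h (carrier M) (carrier N)}"

definition is_basis :: "('r, 'k) ring_scheme \<Rightarrow> ('r, 'a) module \<Rightarrow> 'a set \<Rightarrow> bool" where
  "is_basis R M B \<longleftrightarrow> B \<subseteq> carrier M \<and>
     (\<forall>x\<in>carrier M. \<exists>!c. c \<in> B \<rightarrow>\<^sub>E carrier R \<and> finite {b \<in> B. c b \<noteq> \<zero>\<^bsub>R\<^esub>} \<and>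
        x = (\<Oplus>\<^bsub>M\<^esub>b\<in>{b \<in> B. c b \<noteq> \<zero>\<^bsub>R\<^esub>}. c b \<odot>\<^bsub>M\<^esub> b))"

definition free_module :: "('r, 'k) ring_scheme \<Rightarrow> ('r, 'a) module \<Rightarrow> bool" where
  "free_module R M \<longleftrightarrow> left_module R M \<and> (\<exists>B. is_basis R M B)"

definition quotient_module :: "('r, 'a) module \<Rightarrow> 'a set \<Rightarrow> ('r, 'a set) module" where
  "quotient_module M N =
     \<lparr>carrier = a_rcosets\<^bsub>M\<^esub> N, mult = undefined, one = undefined,
      zero = N, add = (\<lambda>C D. C <+>\<^bsub>M\<^esub> D),
      smult = (\<lambda>a C. \<Union>x\<in>C. N +>\<^bsub>M\<^esub> (a \<odot>\<^bsub>M\<^esub> x))\<rparr>"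

definition coker :: "('r, 'a) module \<Rightarrow> ('r, 'b) module \<Rightarrow> ('a \<Rightarrow> 'b) \<Rightarrow> ('r, 'b set) module" where
  "coker M N h = quotient_module N (h ` carrier M)"

section \<open>The category of inverse sequences\<close>

text \<open>\<open>smap X n\<close> is the structure map \<open>X\<^sub>n \<rightarrow> X\<^sub>n\<^sub>-\<^sub>1\<close> for \<open>n \<ge> 1\<close>; \<open>smap X 0\<close> is irrelevant.\<close>

record ('r, 'a) inv_seq =
  obj :: "nat \<Rightarrow> ('r, 'a) module"
  smap :: "nat \<Rightarrow> 'a \<Rightarrow> 'a"

definition inverse_sequence :: "('r, 'k) ring_scheme \<Rightarrow> ('r, 'a) inv_seq \<Rightarrow> bool" where
  "inverse_sequence R X \<longleftrightarrow> (\<forall>n. left_module R (obj X n)) \<and>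
     (\<forall>n\<ge>1. smap X n \<in> linear_maps R (obj X n) (obj X (n - 1)))"

definition inv_seq_hom ::
  "('r, 'k) ring_scheme \<Rightarrow> ('r, 'a) inv_seq \<Rightarrow> ('r, 'b) inv_seq \<Rightarrow> (nat \<Rightarrow> 'a \<Rightarrow> 'b) set" where
  "inv_seq_hom R X Y = {f. (\<forall>n. f n \<in> linear_maps R (obj X n) (obj Y n)) \<and>
     (\<forall>n\<ge>1. \<forall>x\<in>carrier (obj X n). f (n - 1) (smap X n x) = smap Y n (f n x))}"

definition inv_seq_id :: "('r, 'a) inv_seq \<Rightarrow> nat \<Rightarrow> 'a \<Rightarrow> 'a" where
  "inv_seq_id X = (\<lambda>n. \<lambda>x\<in>carrier (obj X n). x)"

definition inv_seq_comp ::
  "('r, 'a) inv_seq \<Rightarrow> (nat \<Rightarrow> 'b \<Rightarrow> 'c) \<Rightarrow> (nat \<Rightarrow> 'a \<Rightarrow> 'b) \<Rightarrow> nat \<Rightarrow> 'a \<Rightarrow> 'c" where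
  "inv_seq_comp X g f = (\<lambda>n. compose (carrier (obj X n)) (g n) (f n))"

text \<open>A type \<open>'a\<close> plays the role of a universe: it determines the category of inverse sequences of
  modules whose underlying sets lie in \<open>'a\<close>. Functors are allowed to change the universe; for
  \<open>'b = 'a\<close> the two predicates below are literally "endofunctor" and "natural transformation to
  the identity functor". The latter makes sense for \<open>'b \<noteq> 'a\<close> as well, since linear maps between
  modules living in different universes do. The point of varying \<open>'b\<close> is size: free modules on
  sets built from countable products need not fit into the given type \<open>'a\<close>; they do fit into any
  type receiving an injection from \<open>nat \<Rightarrow> 'a + 'r\<close>, where \<open>'r\<close> is the type of scalars. A functor is given by its effect on objects and its
  effect on morphisms \<open>X \<rightarrow> Y\<close>.\<close>

definition is_inv_seq_functor ::
  "('r, 'k) ring_scheme \<Rightarrow> (('r, 'a) inv_seq \<Rightarrow> ('r, 'b) inv_seq) \<Rightarrow>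
   (('r, 'a) inv_seq \<Rightarrow> ('r, 'a) inv_seq \<Rightarrow> (nat \<Rightarrow> 'a \<Rightarrow> 'a) \<Rightarrow> (nat \<Rightarrow> 'b \<Rightarrow> 'b)) \<Rightarrow> bool" where
  "is_inv_seq_functor R F\<^sub>o F\<^sub>m \<longleftrightarrow>
     (\<forall>X. inverse_sequence R X \<longrightarrow> inverse_sequence R (F\<^sub>o X)) \<and>
     (\<forall>X Y f. inverse_sequence R X \<longrightarrow> inverse_sequence R Y \<longrightarrow> f \<in> inv_seq_hom R X Y \<longrightarrow>
        F\<^sub>m X Y f \<in> inv_seq_hom R (F\<^sub>o X) (F\<^sub>o Y)) \<and>
     (\<forall>X. inverse_sequence R X \<longrightarrow> F\<^sub>m X X (inv_seq_id X) = inv_seq_id (F\<^sub>o X)) \<and>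
     (\<forall>X Y Z f g. inverse_sequence R X \<longrightarrow> inverse_sequence R Y \<longrightarrow> inverse_sequence R Z \<longrightarrow>
        f \<in> inv_seq_hom R X Y \<longrightarrow> g \<in> inv_seq_hom R Y Z \<longrightarrow>
        F\<^sub>m X Z (inv_seq_comp X g f) = inv_seq_comp (F\<^sub>o X) (F\<^sub>m Y Z g) (F\<^sub>m X Y f))"

definition is_natural_to_identity ::
  "('r, 'k) ring_scheme \<Rightarrow> (('r, 'a) inv_seq \<Rightarrow> ('r, 'b) inv_seq) \<Rightarrow>
   (('r, 'a) inv_seq \<Rightarrow> ('r, 'a) inv_seq \<Rightarrow> (nat \<Rightarrow> 'a \<Rightarrow> 'a) \<Rightarrow> (nat \<Rightarrow> 'b \<Rightarrow> 'b)) \<Rightarrow>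
   (('r, 'a) inv_seq \<Rightarrow> nat \<Rightarrow> 'b \<Rightarrow> 'a) \<Rightarrow> bool" where
  "is_natural_to_identity R F\<^sub>o F\<^sub>m \<eta> \<longleftrightarrow>
     (\<forall>X. inverse_sequence R X \<longrightarrow> \<eta> X \<in> inv_seq_hom R (F\<^sub>o X) X) \<and>
     (\<forall>X Y h. inverse_sequence R X \<longrightarrow> inverse_sequence R Y \<longrightarrow> h \<in> inv_seq_hom R X Y \<longrightarrow>
        inv_seq_comp (F\<^sub>o X) (\<eta> Y) (F\<^sub>m X Y h) = inv_seq_comp (F\<^sub>o X) h (\<eta> X))"

definition represents_filtration :: "('r, 'a) inv_seq \<Rightarrow> bool" where
  "represents_filtration A \<longleftrightarrow> (\<forall>n\<ge>1. inj_on (smap A n) (carrier (obj A n)))"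

definition successive_quotient :: "('r, 'a) inv_seq \<Rightarrow> nat \<Rightarrow> ('r, 'a set) module" where
  "successive_quotient A n = coker (obj A (Suc n)) (obj A n) (smap A (Suc n))"

section \<open>The first derived limit\<close>

definition product_module :: "('r, 'a) inv_seq \<Rightarrow> ('r, nat \<Rightarrow> 'a) module" where
  "product_module X =
     \<lparr>carrier = {x. \<forall>n. x n \<in> carrier (obj X n)}, mult = undefined, one = undefined,
      zero = (\<lambda>n. \<zero>\<^bsub>obj X n\<^esub>), add = (\<lambda>x y n. x n \<oplus>\<^bsub>obj X n\<^esub> y n),
      smult = (\<lambda>a x n. a \<odot>\<^bsub>obj X n\<^esub> x n)\<rparr>"

definition one_minus_shift :: "('r, 'a) inv_seq \<Rightarrow> (nat \<Rightarrow> 'a) \<Rightarrow> (nat \<Rightarrow> 'a)" where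
  "one_minus_shift X = (\<lambda>x\<in>carrier (product_module X).
     \<lambda>n. x n \<ominus>\<^bsub>obj X n\<^esub> smap X (Suc n) (x (Suc n)))"

definition lim1 :: "('r, 'a) inv_seq \<Rightarrow> ('r, (nat \<Rightarrow> 'a) set) module" where
  "lim1 X = coker (product_module X) (product_module X) (one_minus_shift X)"

text \<open>The induced map sends the class of \<open>x\<close> to the class of \<open>(f\<^sub>n x\<^sub>n)\<^sub>n\<close>.\<close>

definition lim1_map ::
  "('r, 'a) inv_seq \<Rightarrow> ('r, 'b) inv_seq \<Rightarrow> (nat \<Rightarrow> 'a \<Rightarrow> 'b) \<Rightarrow>
   (nat \<Rightarrow> 'a) set \<Rightarrow> (nat \<Rightarrow> 'b) set" where
  "lim1_map X Y f = (\<lambda>C\<in>carrier (lim1 X).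
     \<Union>x\<in>C. (one_minus_shift Y ` carrier (product_module Y))
              +>\<^bsub>product_module Y\<^esub> (\<lambda>n. f n (x n)))"

end

theory Submission
  imports Defs "HOL-Library.Countable_Set" "HOL-Library.Nat_Bijection"
begin

text \<open>
  The sequence \<open>A\<close> is the filtration of one free module by the kernels of its maps to the finite
  stages of a product of free modules. For a set \<open>S\<close> let \<open>F(S)\<close> be the free module on \<open>S\<close>, and let
  \<open>realize X k : F(X\<^sub>k) \<rightarrow> X\<^sub>k\<close> be the map that is the identity on generators. Put

    \<open>P = {(y, b) \<in> (\<Prod>\<^sub>k X\<^sub>k) \<times> (\<Prod>\<^sub>k F(X\<^sub>k)). y\<^sub>k - s(y\<^sub>k\<^sub>+\<^sub>1) = realize X k b\<^sub>k for all k}\<close>.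

  So \<open>P\<close> consists of the families \<open>y\<close> together with a lift \<open>b\<close> of their defect \<open>(1 - S) y\<close> to the free
  modules. This is the set \<open>witnesses X\<close>. The two projections extend to linear maps
  \<open>entry X k : F(P) \<rightarrow> X\<^sub>k\<close> and \<open>defect X k : F(P) \<rightarrow> F(X\<^sub>k)\<close>, and \<open>A\<^sub>n\<close> is the submodule of \<open>F(P)\<close> on
  which \<open>defect X k\<close> vanishes for all \<open>k < n\<close> (\<open>stage X n\<close>). The morphism is \<open>f\<^sub>n = entry X n\<close>: on
  \<open>A\<^sub>n\<^sub>+\<^sub>1\<close> the defect at \<open>n\<close> vanishes, so that \<open>entry X n = s \<circ> entry X (n + 1)\<close> there. Everything is built
  from \<open>X\<close> without choices, hence is functorial in \<open>X\<close>.

  Given \<open>x \<in> X\<^sub>n\<close>, pushing \<open>x\<close> down the tower gives a family whose defect is \<open>x\<close> at the place \<open>n\<close> and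
  \<open>0\<close> elsewhere (\<open>ex_basic_witness\<close>). It shows three things. First, \<open>f\<^sub>n\<close> is onto. Second,
  \<open>defect X n\<close> maps \<open>A\<^sub>n\<close> onto \<open>F(X\<^sub>n)\<close> with kernel \<open>A\<^sub>n\<^sub>+\<^sub>1\<close>, so that \<open>A\<^sub>n / A\<^sub>n\<^sub>+\<^sub>1\<close> is free. Third,
  \<open>A\<^sub>n\<close> is the kernel of a map from \<open>F(P)\<close> to the free module on \<open>\<Squnion>\<^sub>k\<^sub><\<^sub>n X\<^sub>k\<close> under which every generator
  is the image of a generator; the kernel of such a map is free (\<open>free_kernel\<close>).

  For the first derived limit, surjectivity of every \<open>f\<^sub>n\<close> gives surjectivity. For injectivity let
  \<open>a \<in> \<Prod>\<^sub>n A\<^sub>n\<close> and \<open>f\<^sub>n(a\<^sub>n) = y\<^sub>n - s(y\<^sub>n\<^sub>+\<^sub>1)\<close> for all \<open>n\<close>. With the partial sums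
  \<open>S\<^sub>n = a\<^sub>0 + \<dots> + a\<^sub>n\<^sub>-\<^sub>1\<close> the pair of families \<open>y\<^sub>k + entry X k S\<^sub>k\<close> and \<open>defect X k S\<^sub>k\<^sub>+\<^sub>1\<close> is an element \<open>p\<close>
  of \<open>P\<close>. Then \<open>u\<^sub>n = p - S\<^sub>n\<close>, where \<open>p\<close> is read as a generator of \<open>F(P)\<close>, belongs to \<open>A\<^sub>n\<close> and
  \<open>u\<^sub>n - u\<^sub>n\<^sub>+\<^sub>1 = a\<^sub>n\<close> (\<open>stage_shift_onto\<close>).

  Elements of \<open>F(P)\<close> are finite collections of scalars and of countable families of elements of the
  modules \<open>X\<^sub>k\<close> and of scalars. They can therefore be encoded by sequences in \<open>'x + 'r\<close>
  (\<open>encode_generators\<close>), and the sequence \<open>A\<close> is moved to \<open>'y\<close> along such an encoding.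
\<close>

section \<open>Sequences encoding functions of finite support\<close>

lemma inj_interleave: "inj (\<lambda>(f :: nat \<Rightarrow> 'c, g) n. if even n then f (n div 2) else g (n div 2))"
proof (rule injI, clarify)
  fix f g f' g' :: "nat \<Rightarrow> 'c"
  assume eq: "(\<lambda>n. if even n then f (n div 2) else g (n div 2)) =
              (\<lambda>n. if even n then f' (n div 2) else g' (n div 2))"
  have "f n = f' n" "g n = g' n" for n
    using fun_cong[OF eq, of "2 * n"] fun_cong[OF eq, of "Suc (2 * n)"] by auto
  then show "f = f' \<and> g = g'"
    by auto
qed

lemma inj_diagonalize:
  "inj (\<lambda>F :: nat \<Rightarrow> nat \<Rightarrow> 'c. \<lambda>n. F (fst (prod_decode n)) (snd (prod_decode n)))"
proof (rule injI, rule ext, rule ext)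
  fix F G :: "nat \<Rightarrow> nat \<Rightarrow> 'c" and i j
  assume "(\<lambda>n. F (fst (prod_decode n)) (snd (prod_decode n))) =
          (\<lambda>n. G (fst (prod_decode n)) (snd (prod_decode n)))"
  from fun_cong[OF this, of "prod_encode (i, j)"] show "F i j = G i j"
    by simp
qed

text \<open>A function of finite support is determined by its graph over the support. A countable nonempty set is
  the range of a sequence, so the graph can be stored as a sequence of pairs; no length has to be
  recorded.\<close>

lemma encode_finite_support:
  fixes h :: "'k \<Rightarrow> nat \<Rightarrow> 'c" and j :: "'v \<Rightarrow> 'c" and z :: 'v
  assumes h: "inj_on h S" and "S \<noteq> {}" and j: "inj j"
  shows "\<exists>e :: ('k \<Rightarrow> 'v) \<Rightarrow> nat \<Rightarrow> 'c. inj_on e {g. finite {k. g k \<noteq> z} \<and> {k. g k \<noteq> z} \<subseteq> S}"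
proof -
  obtain k\<^sub>0 where k0: "k\<^sub>0 \<in> S"
    using assms(2) by blast
  \<comment> \<open>The pair \<open>(k\<^sub>0, z)\<close> keeps the graph of the zero function nonempty; it carries no information since only
    values other than \<open>z\<close> matter.\<close>
  define graph where "graph g = insert (k\<^sub>0, z) {(k, g k) |k. g k \<noteq> z}" for g :: "'k \<Rightarrow> 'v"
  let ?G = "{g. finite {k. g k \<noteq> z} \<and> {k. g k \<noteq> z} \<subseteq> S}"
  define enc\<^sub>1 where "enc\<^sub>1 = (\<lambda>(k, v). (\<lambda>(f :: nat \<Rightarrow> 'c, g) n.
    if even n then f (n div 2) else g (n div 2)) (h k, \<lambda>_. j v))"
  define enc where "enc g = (\<lambda>F :: nat \<Rightarrow> nat \<Rightarrow> 'c. \<lambda>n. F (fst (prod_decode n)) (snd (prod_decode n)))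
    (\<lambda>m. enc\<^sub>1 (from_nat_into (graph g) m))" for g
  have enc1: "inj_on enc\<^sub>1 (S \<times> UNIV)"
  proof (rule inj_onI, clarify)
    fix k v k' v'
    assume "k \<in> S" "k' \<in> S" and eq: "enc\<^sub>1 (k, v) = enc\<^sub>1 (k', v')"
    have "(h k, \<lambda>_ :: nat. j v) = (h k', \<lambda>_. j v')"
      by (rule injD[OF inj_interleave]) (use eq in \<open>simp add: enc\<^sub>1_def\<close>)
    then have "h k = h k'" "j v = j v'"
      by (simp_all add: fun_eq_iff)
    then show "k = k' \<and> v = v'"
      using \<open>k \<in> S\<close> \<open>k' \<in> S\<close> by (simp add: inj_on_eq_iff[OF h] inj_eq[OF j])
  qed
  have "inj_on enc ?G"
  proof (rule inj_onI)
    fix g g'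
    assume g: "g \<in> ?G" "g' \<in> ?G" and eq: "enc g = enc g'"
    have range: "range (from_nat_into (graph f)) = graph f" if "f \<in> ?G" for f
    proof -
      have "{(k, f k) |k. f k \<noteq> z} = (\<lambda>k. (k, f k)) ` {k. f k \<noteq> z}"
        by auto
      then have "finite (graph f)"
        using that by (simp add: graph_def)
      then show ?thesis
        by (intro range_from_nat_into) (auto simp: graph_def countable_finite)
    qed
    have sub: "graph f \<subseteq> S \<times> UNIV" if "f \<in> ?G" for f
      using that k0 by (auto simp: graph_def)
    have "(\<lambda>m. enc\<^sub>1 (from_nat_into (graph g) m)) = (\<lambda>m. enc\<^sub>1 (from_nat_into (graph g') m))"
      by (rule injD[OF inj_diagonalize]) (use eq in \<open>simp add: enc_def\<close>)
    then have "enc\<^sub>1 ` graph g = enc\<^sub>1 ` graph g'"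
      using range[OF g(1)] range[OF g(2)] by (metis image_image)
    then have gr: "graph g = graph g'"
      using inj_on_image_eq_iff[OF enc1 sub[OF g(1)] sub[OF g(2)]] by simp
    show "g = g'"
    proof
      fix k
      have iff: "(k, v) \<in> graph f \<longleftrightarrow> v = f k" if "v \<noteq> z" for v f
        using that unfolding graph_def by fast
      show "g k = g' k"
      proof (cases "g k = z")
        case True
        then show ?thesis
          using iff[of "g' k" g] iff[of "g' k" g'] gr by metis
      next
        case False
        then show ?thesis
          using iff[of "g k" g] iff[of "g k" g'] gr by metis
      qed
    qed
  qed
  then show ?thesis
    by blast
qed

text \<open>For \<open>z\<close> the zero of the ring this contains the free module on every set of families with lifted
  defects: the generators are themselves made of functions of finite support.\<close>

abbreviation nested_finite_support :: "'r \<Rightarrow> ((nat \<Rightarrow> 'x) \<times> (nat \<Rightarrow> 'x \<Rightarrow> 'r) \<Rightarrow> 'r) set" where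
  "nested_finite_support z \<equiv>
     {g. finite {p. g p \<noteq> z} \<and> {p. g p \<noteq> z} \<subseteq> {p. \<forall>k. finite {x. snd p k x \<noteq> z}}}"

lemma encode_generators:
  fixes z :: 'r
  shows "\<exists>e :: ((nat \<Rightarrow> 'x) \<times> (nat \<Rightarrow> 'x \<Rightarrow> 'r) \<Rightarrow> 'r) \<Rightarrow> nat \<Rightarrow> 'x + 'r.
    inj_on e (nested_finite_support z)"
proof -
  have Inr: "inj (Inr :: 'r \<Rightarrow> 'x + 'r)"
    by simp
  have "inj_on (\<lambda>x :: 'x. \<lambda>_ :: nat. Inl x :: 'x + 'r) UNIV"
    by (simp add: inj_def fun_eq_iff)
  from encode_finite_support[OF this _ Inr, of z]
  obtain h where h: "inj_on (h :: ('x \<Rightarrow> 'r) \<Rightarrow> nat \<Rightarrow> 'x + 'r) {g. finite {x. g x \<noteq> z}}"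
    by auto
  define l where "l = (\<lambda>p :: (nat \<Rightarrow> 'x) \<times> (nat \<Rightarrow> 'x \<Rightarrow> 'r).
    (\<lambda>(f :: nat \<Rightarrow> 'x + 'r, g) n. if even n then f (n div 2) else g (n div 2))
      (\<lambda>n. Inl (fst p n), (\<lambda>F :: nat \<Rightarrow> nat \<Rightarrow> 'x + 'r. \<lambda>n. F (fst (prod_decode n)) (snd (prod_decode n)))
                            (\<lambda>k. h (snd p k))))"
  have "inj_on l {p. \<forall>k. finite {x. snd p k x \<noteq> z}}"
  proof (rule inj_onI)
    fix p q
    assume p: "p \<in> {p. \<forall>k. finite {x. snd p k x \<noteq> z}}" "q \<in> {p. \<forall>k. finite {x. snd p k x \<noteq> z}}"
      and eq: "l p = l q"
    note * = injD[OF inj_interleave eq[unfolded l_def]]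
    have "(\<lambda>n. Inl (fst p n) :: 'x + 'r) = (\<lambda>n. Inl (fst q n))"
      using * by simp
    then have "fst p = fst q"
      by (simp add: fun_eq_iff)
    moreover have "(\<lambda>k. h (snd p k)) = (\<lambda>k. h (snd q k))"
      by (rule injD[OF inj_diagonalize]) (use * in simp)
    then have "h (snd p k) = h (snd q k)" for k
      by (rule fun_cong)
    then have "snd p k = snd q k" for k
      using p by (intro inj_onD[OF h]) auto
    ultimately show "p = q"
      by (simp add: prod_eq_iff fun_eq_iff)
  qed
  moreover have "(undefined, \<lambda>_ _. z) \<in> {p. \<forall>k. finite {x. snd p k x \<noteq> z}}"
    by simp
  then have "{p :: (nat \<Rightarrow> 'x) \<times> (nat \<Rightarrow> 'x \<Rightarrow> 'r). \<forall>k. finite {x. snd p k x \<noteq> z}} \<noteq> {}"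
    by fast
  ultimately show ?thesis
    by (rule encode_finite_support[OF _ _ Inr])
qed

section \<open>Left modules and linear maps\<close>

context left_module
begin

lemma smult_r_null: "a \<in> carrier R \<Longrightarrow> a \<odot>\<^bsub>M\<^esub> \<zero>\<^bsub>M\<^esub> = \<zero>\<^bsub>M\<^esub>"
proof -
  assume a: "a \<in> carrier R"
  have "a \<odot>\<^bsub>M\<^esub> \<zero>\<^bsub>M\<^esub> \<oplus>\<^bsub>M\<^esub> a \<odot>\<^bsub>M\<^esub> \<zero>\<^bsub>M\<^esub> = a \<odot>\<^bsub>M\<^esub> \<zero>\<^bsub>M\<^esub>"
    using smult_r_distr[of a "\<zero>\<^bsub>M\<^esub>" "\<zero>\<^bsub>M\<^esub>"] a by simp
  then show ?thesis
    using a by (simp add: smult_closed M.add.r_cancel_one)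
qed

lemma smult_l_null: "x \<in> carrier M \<Longrightarrow> \<zero>\<^bsub>R\<^esub> \<odot>\<^bsub>M\<^esub> x = \<zero>\<^bsub>M\<^esub>"
proof -
  assume x: "x \<in> carrier M"
  have "\<zero>\<^bsub>R\<^esub> \<odot>\<^bsub>M\<^esub> x \<oplus>\<^bsub>M\<^esub> \<zero>\<^bsub>R\<^esub> \<odot>\<^bsub>M\<^esub> x = \<zero>\<^bsub>R\<^esub> \<odot>\<^bsub>M\<^esub> x"
    using smult_l_distr[of "\<zero>\<^bsub>R\<^esub>" "\<zero>\<^bsub>R\<^esub>" x] x by simp
  then show ?thesis
    using x by (simp add: smult_closed M.add.r_cancel_one)
qed

lemma smult_l_minus_one: "x \<in> carrier M \<Longrightarrow> (\<ominus>\<^bsub>R\<^esub> \<one>\<^bsub>R\<^esub>) \<odot>\<^bsub>M\<^esub> x = \<ominus>\<^bsub>M\<^esub> x"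
proof -
  assume x: "x \<in> carrier M"
  have "(\<ominus>\<^bsub>R\<^esub> \<one>\<^bsub>R\<^esub>) \<odot>\<^bsub>M\<^esub> x \<oplus>\<^bsub>M\<^esub> x = \<zero>\<^bsub>M\<^esub>"
    using smult_l_distr[of "\<ominus>\<^bsub>R\<^esub> \<one>\<^bsub>R\<^esub>" "\<one>\<^bsub>R\<^esub>" x] x
    by (simp add: R.l_neg smult_one smult_l_null)
  then show ?thesis
    using x by (metis M.minus_equality R.one_closed R.a_inv_closed smult_closed)
qed

lemma trivial_scalars: "\<one>\<^bsub>R\<^esub> = \<zero>\<^bsub>R\<^esub> \<Longrightarrow> x \<in> carrier M \<Longrightarrow> x = \<zero>\<^bsub>M\<^esub>"
  using smult_one smult_l_null by metis

end

lemma linear_mapsI: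
  assumes "\<And>x. x \<in> carrier M \<Longrightarrow> h x \<in> carrier N" "\<And>x. x \<notin> carrier M \<Longrightarrow> h x = undefined"
    "\<And>x y. x \<in> carrier M \<Longrightarrow> y \<in> carrier M \<Longrightarrow> h (x \<oplus>\<^bsub>M\<^esub> y) = h x \<oplus>\<^bsub>N\<^esub> h y"
    "\<And>a x. a \<in> carrier R \<Longrightarrow> x \<in> carrier M \<Longrightarrow> h (a \<odot>\<^bsub>M\<^esub> x) = a \<odot>\<^bsub>N\<^esub> h x"
  shows "h \<in> linear_maps R M N"
  using assms unfolding linear_maps_def by auto

lemma linear_maps_closed: "h \<in> linear_maps R M N \<Longrightarrow> x \<in> carrier M \<Longrightarrow> h x \<in> carrier N"
  and linear_maps_add: "h \<in> linear_maps R M N \<Longrightarrow> x \<in> carrier M \<Longrightarrow> y \<in> carrier M \<Longrightarrow>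
    h (x \<oplus>\<^bsub>M\<^esub> y) = h x \<oplus>\<^bsub>N\<^esub> h y"
  and linear_maps_smult: "h \<in> linear_maps R M N \<Longrightarrow> a \<in> carrier R \<Longrightarrow> x \<in> carrier M \<Longrightarrow>
    h (a \<odot>\<^bsub>M\<^esub> x) = a \<odot>\<^bsub>N\<^esub> h x"
  unfolding linear_maps_def by auto

lemma linear_maps_zero:
  assumes "h \<in> linear_maps R M N" "left_module R M" "left_module R N"
  shows "h \<zero>\<^bsub>M\<^esub> = \<zero>\<^bsub>N\<^esub>"
proof -
  interpret M: left_module R M by fact
  interpret N: left_module R N by fact
  have "h \<zero>\<^bsub>M\<^esub> = h (\<zero>\<^bsub>R\<^esub> \<odot>\<^bsub>M\<^esub> \<zero>\<^bsub>M\<^esub>)"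
    by (simp add: M.smult_l_null)
  also have "\<dots> = \<zero>\<^bsub>N\<^esub>"
    using assms(1) by (simp add: linear_maps_smult[OF assms(1)] N.smult_l_null linear_maps_closed[OF assms(1)])
  finally show ?thesis .
qed

lemma linear_maps_neg:
  assumes "h \<in> linear_maps R M N" "left_module R M" "left_module R N" "x \<in> carrier M"
  shows "h (\<ominus>\<^bsub>M\<^esub> x) = \<ominus>\<^bsub>N\<^esub> h x"
proof -
  interpret M: left_module R M by fact
  interpret N: left_module R N by fact
  show ?thesis
    using assms(4) linear_maps_smult[OF assms(1), of "\<ominus>\<^bsub>R\<^esub> \<one>\<^bsub>R\<^esub>" x] linear_maps_closed[OF assms(1,4)]
    by (simp add: M.smult_l_minus_one N.smult_l_minus_one)
qed

lemma linear_maps_diff: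
  assumes "h \<in> linear_maps R M N" "left_module R M" "left_module R N" "x \<in> carrier M" "y \<in> carrier M"
  shows "h (x \<ominus>\<^bsub>M\<^esub> y) = h x \<ominus>\<^bsub>N\<^esub> h y"
proof -
  interpret M: left_module R M by fact
  show ?thesis
    using assms by (simp add: a_minus_def linear_maps_add[OF assms(1)] linear_maps_neg[OF assms(1-3)])
qed

lemma linear_maps_comp:
  assumes "g \<in> linear_maps R N L" "h \<in> linear_maps R M N" "left_module R M"
  shows "compose (carrier M) g h \<in> linear_maps R M L"
proof -
  interpret M: left_module R M by fact
  show ?thesis
    by (rule linear_mapsI)
       (use assms in \<open>auto simp: compose_eq M.smult_closed linear_maps_add linear_maps_smult linear_maps_closed,
         auto simp: compose_def\<close>)
qed

text \<open>This is how the module axioms are obtained for kernels and quotients: they are transported from a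
  free module.\<close>

lemma left_module_transfer:
  assumes L: "left_module R L" and bij: "bij_betw h (carrier L) (carrier Q)"
    and add: "\<And>x y. x \<in> carrier L \<Longrightarrow> y \<in> carrier L \<Longrightarrow> h (x \<oplus>\<^bsub>L\<^esub> y) = h x \<oplus>\<^bsub>Q\<^esub> h y"
    and smult: "\<And>a x. a \<in> carrier R \<Longrightarrow> x \<in> carrier L \<Longrightarrow> h (a \<odot>\<^bsub>L\<^esub> x) = a \<odot>\<^bsub>Q\<^esub> h x"
    and zero: "h \<zero>\<^bsub>L\<^esub> = \<zero>\<^bsub>Q\<^esub>"
  shows "left_module R Q"
proof -
  interpret L: left_module R L by fact
  note [simp] = add[symmetric] smult[symmetric] zero[symmetric] L.smult_closed
  have Q: "carrier Q = h ` carrier L"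
    using bij by (simp add: bij_betw_def)
  have "abelian_group Q"
    by (rule abelian_groupI)
       (auto simp: Q L.M.a_ac L.M.l_neg L.M.r_neg intro!: arg_cong[of _ _ h] bexI[of _ "\<ominus>\<^bsub>L\<^esub> _"])
  then show ?thesis
    by (intro left_module.intro left_module_axioms.intro L.R.ring_axioms)
       (auto simp: Q L.smult_l_distr L.smult_r_distr L.smult_assoc L.smult_one)
qed

section \<open>Free modules on a set\<close>

text \<open>Elements are functions on the whole type that vanish outside \<open>S\<close>, so that equality of elements is
  equality of functions and all operations are pointwise.\<close>

definition free_on :: "('r, 'k) ring_scheme \<Rightarrow> 's set \<Rightarrow> ('r, 's \<Rightarrow> 'r) module" where
  "free_on R S = \<lparr>carrier = {g \<in> UNIV \<rightarrow> carrier R. finite {s. g s \<noteq> \<zero>\<^bsub>R\<^esub>} \<and> {s. g s \<noteq> \<zero>\<^bsub>R\<^esub>} \<subseteq> S},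
     mult = undefined, one = undefined, zero = (\<lambda>_. \<zero>\<^bsub>R\<^esub>), add = (\<lambda>g h s. g s \<oplus>\<^bsub>R\<^esub> h s),
     smult = (\<lambda>a g s. a \<otimes>\<^bsub>R\<^esub> g s)\<rparr>"

definition gen :: "('r, 'k) ring_scheme \<Rightarrow> 's \<Rightarrow> 's \<Rightarrow> 'r" where
  "gen R s = (\<lambda>t. if t = s then \<one>\<^bsub>R\<^esub> else \<zero>\<^bsub>R\<^esub>)"

definition lin_ext ::
  "('r, 'k) ring_scheme \<Rightarrow> 's set \<Rightarrow> ('r, 'a) module \<Rightarrow> ('s \<Rightarrow> 'a) \<Rightarrow> ('s \<Rightarrow> 'r) \<Rightarrow> 'a" where
  "lin_ext R S N \<phi> = (\<lambda>g\<in>carrier (free_on R S). \<Oplus>\<^bsub>N\<^esub>s\<in>{s. g s \<noteq> \<zero>\<^bsub>R\<^esub>}. g s \<odot>\<^bsub>N\<^esub> \<phi> s)"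

lemma free_on_carrier:
  "g \<in> carrier (free_on R S) \<longleftrightarrow>
     (\<forall>s. g s \<in> carrier R) \<and> finite {s. g s \<noteq> \<zero>\<^bsub>R\<^esub>} \<and> {s. g s \<noteq> \<zero>\<^bsub>R\<^esub>} \<subseteq> S"
  by (auto simp: free_on_def)

lemma free_on_simps [simp]:
  "\<zero>\<^bsub>free_on R S\<^esub> = (\<lambda>_. \<zero>\<^bsub>R\<^esub>)"
  "g \<oplus>\<^bsub>free_on R S\<^esub> h = (\<lambda>s. g s \<oplus>\<^bsub>R\<^esub> h s)"
  "a \<odot>\<^bsub>free_on R S\<^esub> g = (\<lambda>s. a \<otimes>\<^bsub>R\<^esub> g s)"
  by (simp_all add: free_on_def)

context ring
begin

lemma free_on_add_closed:
  assumes "g \<in> carrier (free_on R S)" "h \<in> carrier (free_on R S)"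
  shows "(\<lambda>s. g s \<oplus> h s) \<in> carrier (free_on R S)"
proof -
  have sub: "{s. g s \<oplus> h s \<noteq> \<zero>} \<subseteq> {s. g s \<noteq> \<zero>} \<union> {s. h s \<noteq> \<zero>}"
    by auto
  have "finite {s. g s \<oplus> h s \<noteq> \<zero>}" "{s. g s \<oplus> h s \<noteq> \<zero>} \<subseteq> S"
    using assms sub finite_subset[OF sub] by (auto simp: free_on_carrier)
  then show ?thesis
    using assms by (simp add: free_on_carrier)
qed

lemma free_on_smult_closed:
  assumes "g \<in> carrier (free_on R S)" "a \<in> carrier R"
  shows "(\<lambda>s. a \<otimes> g s) \<in> carrier (free_on R S)"
proof -
  have sub: "{s. a \<otimes> g s \<noteq> \<zero>} \<subseteq> {s. g s \<noteq> \<zero>}"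
    using assms by auto
  have "finite {s. a \<otimes> g s \<noteq> \<zero>}" "{s. a \<otimes> g s \<noteq> \<zero>} \<subseteq> S"
    using assms sub finite_subset[OF sub] by (auto simp: free_on_carrier)
  then show ?thesis
    using assms by (simp add: free_on_carrier)
qed

lemma free_on_left_module: "left_module R (free_on R S)"
proof (intro left_module.intro left_module_axioms.intro ring_axioms)
  show "abelian_group (free_on R S)"
  proof (rule abelian_groupI)
    fix g assume g: "g \<in> carrier (free_on R S)"
    have "(\<lambda>s. (\<ominus> \<one>) \<otimes> g s) \<in> carrier (free_on R S)"
      by (rule free_on_smult_closed[OF g]) simp
    then show "\<exists>y\<in>carrier (free_on R S). y \<oplus>\<^bsub>free_on R S\<^esub> g = \<zero>\<^bsub>free_on R S\<^esub>"
      using g by (intro bexI[of _ "\<lambda>s. (\<ominus> \<one>) \<otimes> g s"]) (auto simp: free_on_carrier l_minus l_neg)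
  qed (auto simp: free_on_add_closed, auto simp: free_on_carrier a_ac)
qed (auto simp: free_on_smult_closed, auto simp: free_on_carrier l_distr r_distr m_assoc)

lemma gen_closed: "s \<in> S \<Longrightarrow> gen R s \<in> carrier (free_on R S)"
  by (auto simp: free_on_carrier gen_def)

lemma free_on_minus:
  assumes "g \<in> carrier (free_on R S)" "h \<in> carrier (free_on R S)"
  shows "g \<ominus>\<^bsub>free_on R S\<^esub> h = (\<lambda>s. g s \<ominus> h s)"
proof -
  interpret F: left_module R "free_on R S"
    by (rule free_on_left_module)
  have "\<ominus>\<^bsub>free_on R S\<^esub> h = (\<ominus> \<one>) \<odot>\<^bsub>free_on R S\<^esub> h"
    using F.smult_l_minus_one[OF assms(2)] by simp
  then show ?thesis
    using assms by (auto simp: a_minus_def free_on_carrier l_minus)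
qed

lemma free_on_induct [consumes 1, case_names zero add]:
  assumes g: "g \<in> carrier (free_on R S)"
    and zero: "P (\<lambda>_. \<zero>)"
    and add: "\<And>g a s. g \<in> carrier (free_on R S) \<Longrightarrow> a \<in> carrier R \<Longrightarrow> s \<in> S \<Longrightarrow> P g \<Longrightarrow>
      P (g \<oplus>\<^bsub>free_on R S\<^esub> a \<odot>\<^bsub>free_on R S\<^esub> gen R s)"
  shows "P g"
proof -
  have "finite {s. g s \<noteq> \<zero>}"
    using g by (simp add: free_on_carrier)
  then show ?thesis
    using g
  proof (induction "{s. g s \<noteq> \<zero>}" arbitrary: g rule: finite_induct)
    case empty
    then have "g = (\<lambda>_. \<zero>)"
      by auto
    with zero show ?case
      by simp
  next
    case (insert s W)
    let ?g = "g(s := \<zero>)"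
    have W: "W = {t. ?g t \<noteq> \<zero>}"
      using insert.hyps(2,4) by auto
    have s: "s \<in> S" and gR: "\<And>t. g t \<in> carrier R"
      using insert.hyps(4) insert.prems by (auto simp: free_on_carrier)
    have cl: "?g \<in> carrier (free_on R S)"
      using insert.prems insert.hyps(1) W gR by (auto simp: free_on_carrier)
    have "g = ?g \<oplus>\<^bsub>free_on R S\<^esub> g s \<odot>\<^bsub>free_on R S\<^esub> gen R s"
      using gR by (auto simp: gen_def)
    moreover have "P (?g \<oplus>\<^bsub>free_on R S\<^esub> g s \<odot>\<^bsub>free_on R S\<^esub> gen R s)"
      by (rule add[OF cl gR s insert.hyps(3)[OF W cl]])
    ultimately show ?case
      by simp
  qed
qed

text \<open>The uniqueness half of the universal property of free modules; together with \<open>lin_ext_linear\<close> and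
  \<open>lin_ext_gen\<close> it reduces identities between linear maps on a free module to generators.\<close>

lemma linear_maps_agree:
  assumes f: "f \<in> linear_maps R (free_on R S) N" and g: "g \<in> linear_maps R (free_on R S) N"
    and N: "left_module R N" and eq: "\<And>s. s \<in> S \<Longrightarrow> f (gen R s) = g (gen R s)"
    and x: "x \<in> carrier (free_on R S)"
  shows "f x = g x"
  using x
proof (induction x rule: free_on_induct)
  case zero
  show ?case
    using linear_maps_zero[OF f free_on_left_module N] linear_maps_zero[OF g free_on_left_module N]
    by simp
next
  case (add x a s)
  interpret F: left_module R "free_on R S"
    by (rule free_on_left_module)
  have "a \<odot>\<^bsub>free_on R S\<^esub> gen R s \<in> carrier (free_on R S)"
    using add gen_closed[OF add(3)] by (intro F.smult_closed) auto
  then show ?case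
    using add eq gen_closed[OF add(3)]
    by (simp only: linear_maps_add[OF f] linear_maps_add[OF g] linear_maps_smult[OF f] linear_maps_smult[OF g])
qed

text \<open>Summation over a common finite set of indices makes sums for different elements comparable.\<close>

lemma lin_ext_superset:
  assumes N: "left_module R N" and g: "g \<in> carrier (free_on R S)" and \<phi>: "\<phi> \<in> S \<rightarrow> carrier N"
    and W: "finite W" "{s. g s \<noteq> \<zero>} \<subseteq> W" "W \<subseteq> S"
  shows "lin_ext R S N \<phi> g = (\<Oplus>\<^bsub>N\<^esub>s\<in>W. g s \<odot>\<^bsub>N\<^esub> \<phi> s)"
proof -
  interpret N: left_module R N by fact
  have "(\<Oplus>\<^bsub>N\<^esub>s\<in>{s. g s \<noteq> \<zero>}. g s \<odot>\<^bsub>N\<^esub> \<phi> s) = (\<Oplus>\<^bsub>N\<^esub>s\<in>W. g s \<odot>\<^bsub>N\<^esub> \<phi> s)"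
    by (rule N.M.add.finprod_mono_neutral_cong_left)
       (use W g \<phi> in \<open>auto simp: free_on_carrier subset_iff Pi_iff intro!: N.smult_closed N.smult_l_null\<close>)
  then show ?thesis
    using g by (simp add: lin_ext_def)
qed

lemma lin_ext_linear:
  assumes N: "left_module R N" and \<phi>: "\<phi> \<in> S \<rightarrow> carrier N"
  shows "lin_ext R S N \<phi> \<in> linear_maps R (free_on R S) N"
proof -
  interpret N: left_module R N by fact
  interpret F: left_module R "free_on R S"
    by (rule free_on_left_module)
  have term_closed: "(\<lambda>s. g s \<odot>\<^bsub>N\<^esub> \<phi> s) \<in> W \<rightarrow> carrier N"
    if "g \<in> carrier (free_on R S)" "W \<subseteq> S" for g W
    using that \<phi> by (auto simp: free_on_carrier intro!: N.smult_closed)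
  show ?thesis
  proof (rule linear_mapsI)
    fix g assume g: "g \<in> carrier (free_on R S)"
    then show "lin_ext R S N \<phi> g \<in> carrier N"
      using term_closed[OF g] by (auto simp: lin_ext_def free_on_carrier intro!: N.M.finsum_closed)
    fix h assume h: "h \<in> carrier (free_on R S)"
    let ?W = "{s. g s \<noteq> \<zero>} \<union> {s. h s \<noteq> \<zero>}"
    have W: "finite ?W" "?W \<subseteq> S"
      using g h by (auto simp: free_on_carrier)
    have in_W: "g s \<in> carrier R" "h s \<in> carrier R" "\<phi> s \<in> carrier N" if "s \<in> ?W" for s
      using that g h W(2) \<phi> by (auto simp: free_on_carrier)
    have supp: "{s. (g \<oplus>\<^bsub>free_on R S\<^esub> h) s \<noteq> \<zero>} \<subseteq> ?W"
      by auto
    have "lin_ext R S N \<phi> (g \<oplus>\<^bsub>free_on R S\<^esub> h) = (\<Oplus>\<^bsub>N\<^esub>s\<in>?W. (g s \<oplus> h s) \<odot>\<^bsub>N\<^esub> \<phi> s)"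
      using lin_ext_superset[OF N F.M.a_closed[OF g h] \<phi> W(1) supp W(2)] by simp
    also have "\<dots> = (\<Oplus>\<^bsub>N\<^esub>s\<in>?W. g s \<odot>\<^bsub>N\<^esub> \<phi> s \<oplus>\<^bsub>N\<^esub> h s \<odot>\<^bsub>N\<^esub> \<phi> s)"
    proof (rule N.M.finsum_cong')
      show "(\<lambda>s. g s \<odot>\<^bsub>N\<^esub> \<phi> s \<oplus>\<^bsub>N\<^esub> h s \<odot>\<^bsub>N\<^esub> \<phi> s) \<in> ?W \<rightarrow> carrier N"
        by (rule Pi_I) (intro N.M.a_closed N.smult_closed in_W)
      show "(g s \<oplus> h s) \<odot>\<^bsub>N\<^esub> \<phi> s = g s \<odot>\<^bsub>N\<^esub> \<phi> s \<oplus>\<^bsub>N\<^esub> h s \<odot>\<^bsub>N\<^esub> \<phi> s" if "s \<in> ?W" for s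
        by (intro N.smult_l_distr in_W that)
    qed (rule refl)
    also have "\<dots> = (\<Oplus>\<^bsub>N\<^esub>s\<in>?W. g s \<odot>\<^bsub>N\<^esub> \<phi> s) \<oplus>\<^bsub>N\<^esub> (\<Oplus>\<^bsub>N\<^esub>s\<in>?W. h s \<odot>\<^bsub>N\<^esub> \<phi> s)"
      by (rule N.M.finsum_addf) (rule term_closed[OF g W(2)], rule term_closed[OF h W(2)])
    also have "\<dots> = lin_ext R S N \<phi> g \<oplus>\<^bsub>N\<^esub> lin_ext R S N \<phi> h"
      using lin_ext_superset[OF N g \<phi> W(1) _ W(2)] lin_ext_superset[OF N h \<phi> W(1) _ W(2)] by simp
    finally show "lin_ext R S N \<phi> (g \<oplus>\<^bsub>free_on R S\<^esub> h) = lin_ext R S N \<phi> g \<oplus>\<^bsub>N\<^esub> lin_ext R S N \<phi> h" .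
  next
    fix a g assume a: "a \<in> carrier R" and g: "g \<in> carrier (free_on R S)"
    have smult_sum: "a \<odot>\<^bsub>N\<^esub> (\<Oplus>\<^bsub>N\<^esub>s\<in>W. g s \<odot>\<^bsub>N\<^esub> \<phi> s) = (\<Oplus>\<^bsub>N\<^esub>s\<in>W. (a \<otimes> g s) \<odot>\<^bsub>N\<^esub> \<phi> s)"
      if "finite W" "W \<subseteq> S" for W
      using that
    proof (induction W rule: finite_induct)
      case empty
      then show ?case
        using a by (simp add: N.smult_r_null)
    next
      case (insert s W)
      have gs: "g s \<in> carrier R" "\<phi> s \<in> carrier N"
        using g \<phi> insert.prems by (auto simp: free_on_carrier)
      have "(\<lambda>s. g s \<odot>\<^bsub>N\<^esub> \<phi> s) \<in> W \<rightarrow> carrier N" "(\<lambda>s. (a \<otimes> g s) \<odot>\<^bsub>N\<^esub> \<phi> s) \<in> W \<rightarrow> carrier N"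
        using term_closed[OF g, of W] term_closed[OF F.smult_closed[OF a g], of W] insert.prems by auto
      then show ?case
        using insert a gs by (simp add: N.smult_closed N.smult_r_distr N.smult_assoc N.M.finsum_closed)
    qed
    have "{s. g s \<noteq> \<zero>} \<subseteq> S" "finite {s. g s \<noteq> \<zero>}"
      using g by (auto simp: free_on_carrier)
    moreover have "{s. a \<otimes> g s \<noteq> \<zero>} \<subseteq> {s. g s \<noteq> \<zero>}"
      using a by auto
    ultimately show "lin_ext R S N \<phi> (a \<odot>\<^bsub>free_on R S\<^esub> g) = a \<odot>\<^bsub>N\<^esub> lin_ext R S N \<phi> g"
      using lin_ext_superset[OF N F.smult_closed[OF a g] \<phi>, of "{s. g s \<noteq> \<zero>}"]
        lin_ext_superset[OF N g \<phi>, of "{s. g s \<noteq> \<zero>}"] smult_sum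
      by simp
  qed (simp add: lin_ext_def)
qed

lemma lin_ext_gen:
  assumes N: "left_module R N" and \<phi>: "\<phi> \<in> S \<rightarrow> carrier N" and s: "s \<in> S"
  shows "lin_ext R S N \<phi> (gen R s) = \<phi> s"
proof -
  interpret N: left_module R N by fact
  have "lin_ext R S N \<phi> (gen R s) = (\<Oplus>\<^bsub>N\<^esub>t\<in>{s}. gen R s t \<odot>\<^bsub>N\<^esub> \<phi> t)"
    using s by (intro lin_ext_superset[OF N gen_closed[OF s] \<phi>]) (auto simp: gen_def)
  then show ?thesis
    using \<phi> s by (auto simp: gen_def N.smult_one Pi_iff)
qed

end

text \<open>The basis is the image of the generators. Over the zero ring all generators coincide and \<open>S\<close> does
  not index a basis; there the module is zero and the empty set is a basis.\<close>

lemma free_moduleI: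
  assumes R: "ring R" and \<Phi>: "\<Phi> \<in> linear_isos R (free_on R S) M" and zero: "\<Phi> (\<lambda>_. \<zero>\<^bsub>R\<^esub>) = \<zero>\<^bsub>M\<^esub>"
  shows "free_module R M"
proof -
  interpret R: ring R by fact
  interpret F: left_module R "free_on R S"
    by (rule R.free_on_left_module)
  have lin: "\<Phi> \<in> linear_maps R (free_on R S) M" and bij: "bij_betw \<Phi> (carrier (free_on R S)) (carrier M)"
    using \<Phi> by (auto simp: linear_isos_def)
  have M: "left_module R M"
    using F.left_module_axioms bij
    by (rule left_module_transfer) (simp_all only: linear_maps_add[OF lin] linear_maps_smult[OF lin], simp add: zero)
  interpret M: left_module R M by fact
  have "\<exists>B. is_basis R M B"
  proof (cases "\<one>\<^bsub>R\<^esub> = \<zero>\<^bsub>R\<^esub>")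
    case True
    have "\<exists>!c. c \<in> {} \<rightarrow>\<^sub>E carrier R \<and> finite {b \<in> {}. c b \<noteq> \<zero>\<^bsub>R\<^esub>} \<and>
        x = (\<Oplus>\<^bsub>M\<^esub>b\<in>{b \<in> {}. c b \<noteq> \<zero>\<^bsub>R\<^esub>}. c b \<odot>\<^bsub>M\<^esub> b)" if "x \<in> carrier M" for x
      by (simp add: M.trivial_scalars[OF True that])
    then have "is_basis R M {}"
      unfolding is_basis_def by blast
    then show ?thesis
      by blast
  next
    case False
    define e where "e s = \<Phi> (gen R s)" for s
    define B where "B = e ` S"
    have e: "e \<in> S \<rightarrow> carrier M"
      by (rule Pi_I) (unfold e_def, rule linear_maps_closed[OF lin], rule R.gen_closed)
    have inj: "inj_on e S"
    proof (rule inj_onI)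
      fix s t assume st: "s \<in> S" "t \<in> S" "e s = e t"
      have "gen R s = gen R t"
        by (rule inj_onD[OF bij_betw_imp_inj_on[OF bij]])
           (use st in \<open>auto simp: e_def R.gen_closed\<close>)
      from fun_cong[OF this, of s] show "s = t"
        using False by (auto simp: gen_def split: if_splits)
    qed
    have val: "(\<Oplus>\<^bsub>M\<^esub>b\<in>{b \<in> B. c b \<noteq> \<zero>\<^bsub>R\<^esub>}. c b \<odot>\<^bsub>M\<^esub> b) = \<Phi> w" and wF: "w \<in> carrier (free_on R S)"
      if c: "c \<in> B \<rightarrow> carrier R" "finite {b \<in> B. c b \<noteq> \<zero>\<^bsub>R\<^esub>}"
        and w: "w = (\<lambda>s. if s \<in> S then c (e s) else \<zero>\<^bsub>R\<^esub>)" for c w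
    proof -
      have supp: "{b \<in> B. c b \<noteq> \<zero>\<^bsub>R\<^esub>} = e ` {s. w s \<noteq> \<zero>\<^bsub>R\<^esub>}"
        unfolding B_def w by auto
      have sub: "{s. w s \<noteq> \<zero>\<^bsub>R\<^esub>} \<subseteq> S"
        unfolding w by auto
      have inj': "inj_on e {s. w s \<noteq> \<zero>\<^bsub>R\<^esub>}"
        using inj sub by (rule inj_on_subset)
      have "finite {s. w s \<noteq> \<zero>\<^bsub>R\<^esub>}"
        using c(2) supp inj' by (simp add: finite_image_iff)
      then show w': "w \<in> carrier (free_on R S)"
        using c(1) sub by (auto simp: free_on_carrier w B_def)
      have "\<Phi> w = lin_ext R S M e w"
        by (rule R.linear_maps_agree[OF lin R.lin_ext_linear[OF M e] M _ w'])
           (simp add: R.lin_ext_gen[OF M e] e_def)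
      also have "\<dots> = (\<Oplus>\<^bsub>M\<^esub>s\<in>{s. w s \<noteq> \<zero>\<^bsub>R\<^esub>}. w s \<odot>\<^bsub>M\<^esub> e s)"
        using w' by (simp add: lin_ext_def)
      also have "\<dots> = (\<Oplus>\<^bsub>M\<^esub>s\<in>{s. w s \<noteq> \<zero>\<^bsub>R\<^esub>}. c (e s) \<odot>\<^bsub>M\<^esub> e s)"
        by (rule M.M.finsum_cong') (use c(1) e sub in \<open>auto simp: w B_def Pi_iff split: if_splits intro!: M.smult_closed\<close>)
      also have "\<dots> = (\<Oplus>\<^bsub>M\<^esub>b\<in>e ` {s. w s \<noteq> \<zero>\<^bsub>R\<^esub>}. c b \<odot>\<^bsub>M\<^esub> b)"
        by (rule M.M.finsum_reindex[symmetric, OF _ inj'])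
           (use c(1) e sub in \<open>auto simp: B_def Pi_iff subset_iff intro!: M.smult_closed\<close>)
      finally show "(\<Oplus>\<^bsub>M\<^esub>b\<in>{b \<in> B. c b \<noteq> \<zero>\<^bsub>R\<^esub>}. c b \<odot>\<^bsub>M\<^esub> b) = \<Phi> w"
        using supp by simp
    qed
    have "is_basis R M B"
      unfolding is_basis_def
    proof (intro conjI ballI)
      show "B \<subseteq> carrier M"
        using e by (auto simp: B_def)
      fix x assume "x \<in> carrier M"
      then obtain w where w: "w \<in> carrier (free_on R S)" "x = \<Phi> w"
        using bij by (auto simp: bij_betw_def)
      define c where "c = (\<lambda>b\<in>B. w (inv_into S e b))"
      have c: "c \<in> B \<rightarrow>\<^sub>E carrier R"
        using w by (auto simp: c_def free_on_carrier)
      have ce: "c (e s) = w s" if "s \<in> S" for s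
        using that inj by (simp add: c_def B_def)
      have "{b \<in> B. c b \<noteq> \<zero>\<^bsub>R\<^esub>} \<subseteq> e ` {s. w s \<noteq> \<zero>\<^bsub>R\<^esub>}"
        using ce by (auto simp: B_def)
      then have fin: "finite {b \<in> B. c b \<noteq> \<zero>\<^bsub>R\<^esub>}"
        using w by (auto simp: free_on_carrier intro: finite_subset)
      have wc: "w = (\<lambda>s. if s \<in> S then c (e s) else \<zero>\<^bsub>R\<^esub>)"
        using w(1) ce by (intro ext) (auto simp: free_on_carrier)
      show "\<exists>!c. c \<in> B \<rightarrow>\<^sub>E carrier R \<and> finite {b \<in> B. c b \<noteq> \<zero>\<^bsub>R\<^esub>} \<and>
        x = (\<Oplus>\<^bsub>M\<^esub>b\<in>{b \<in> B. c b \<noteq> \<zero>\<^bsub>R\<^esub>}. c b \<odot>\<^bsub>M\<^esub> b)"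
      proof (rule ex1I)
        show "c \<in> B \<rightarrow>\<^sub>E carrier R \<and> finite {b \<in> B. c b \<noteq> \<zero>\<^bsub>R\<^esub>} \<and>
          x = (\<Oplus>\<^bsub>M\<^esub>b\<in>{b \<in> B. c b \<noteq> \<zero>\<^bsub>R\<^esub>}. c b \<odot>\<^bsub>M\<^esub> b)"
          using c fin val[of c w] wc w(2) by (auto simp: PiE_def)
      next
        fix d assume d: "d \<in> B \<rightarrow>\<^sub>E carrier R \<and> finite {b \<in> B. d b \<noteq> \<zero>\<^bsub>R\<^esub>} \<and>
          x = (\<Oplus>\<^bsub>M\<^esub>b\<in>{b \<in> B. d b \<noteq> \<zero>\<^bsub>R\<^esub>}. d b \<odot>\<^bsub>M\<^esub> b)"
        define v where "v = (\<lambda>s. if s \<in> S then d (e s) else \<zero>\<^bsub>R\<^esub>)"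
        have d': "d \<in> B \<rightarrow> carrier R" "finite {b \<in> B. d b \<noteq> \<zero>\<^bsub>R\<^esub>}"
          using d by (auto simp: PiE_def)
        have "\<Phi> v = \<Phi> w" "v \<in> carrier (free_on R S)"
          using val[OF d' v_def] wF[OF d' v_def] d w(2) by auto
        then have "v = w"
          using bij w(1) by (auto simp: bij_betw_def inj_on_def)
        show "d = c"
        proof (rule PiE_ext)
          fix b assume "b \<in> B"
          then obtain s where "s \<in> S" "b = e s"
            by (auto simp: B_def)
          then show "d b = c b"
            using fun_cong[OF \<open>v = w\<close>, of s] ce by (simp add: v_def)
        qed (use d c in auto)
      qed
    qed
    then show ?thesis
      by blast
  qed
  with M show ?thesis
    by (simp add: free_module_def)
qed

section \<open>Kernels of split surjections between free modules\<close>

lemma bij_betwI_inj_surj: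
  assumes "inj_on f A" "\<And>y. y \<in> B \<Longrightarrow> y \<in> f ` A" "f ` A \<subseteq> B"
  shows "bij_betw f A B"
  using assms by (auto simp: bij_betw_def)

lemma (in abelian_group) add_diff_add:
  assumes "a \<in> carrier G" "b \<in> carrier G" "c \<in> carrier G" "d \<in> carrier G"
  shows "(a \<oplus> b) \<ominus> (c \<oplus> d) = (a \<ominus> c) \<oplus> (b \<ominus> d)"
  using assms by (simp add: a_minus_def minus_add a_ac)

text \<open>Let \<open>u \<mapsto> push u\<close> be the section of \<open>g\<close> given by \<open>\<sigma>\<close> on generators. It embeds \<open>F(T)\<close> as the span of the
  generators \<open>\<sigma> t\<close>, and \<open>F(S)\<close> is the direct sum of this span and of the kernel. Another complement of this span, the
  span of the generators outside \<open>\<sigma> ` T\<close>, is free, and \<open>u \<mapsto> u - push (g u)\<close> maps it isomorphically to the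
  kernel. Over the zero ring \<open>\<sigma>\<close> may fail to be injective, but then all modules are zero.\<close>

lemma free_kernel:
  fixes S :: "'s set" and T :: "'t set"
  assumes R: "ring R" and g: "g \<in> linear_maps R (free_on R S) (free_on R T)"
    and \<sigma>: "\<sigma> \<in> T \<rightarrow> S" and sec: "\<And>t. t \<in> T \<Longrightarrow> g (gen R (\<sigma> t)) = gen R t"
  defines "K \<equiv> (free_on R S)\<lparr>carrier := {x \<in> carrier (free_on R S). g x = (\<lambda>_. \<zero>\<^bsub>R\<^esub>)}\<rparr>"
  shows "\<exists>S' \<Phi>. \<Phi> \<in> linear_isos R (free_on R (S' :: 's set)) K"
proof -
  interpret R: ring R by fact
  interpret S: left_module R "free_on R S"
    by (rule R.free_on_left_module)
  interpret T: left_module R "free_on R T"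
    by (rule R.free_on_left_module)
  have K_simps: "carrier K = {x \<in> carrier (free_on R S). g x = (\<lambda>_. \<zero>\<^bsub>R\<^esub>)}"
    "x \<oplus>\<^bsub>K\<^esub> y = (\<lambda>s. x s \<oplus>\<^bsub>R\<^esub> y s)" "a \<odot>\<^bsub>K\<^esub> x = (\<lambda>s. a \<otimes>\<^bsub>R\<^esub> x s)" for a x y
    by (simp_all add: K_def free_on_def)
  show ?thesis
  proof (cases "\<one>\<^bsub>R\<^esub> = \<zero>\<^bsub>R\<^esub>")
    case True
    have "g x = (\<lambda>_. \<zero>\<^bsub>R\<^esub>)" if "x \<in> carrier (free_on R S)" for x
      using T.trivial_scalars[OF True linear_maps_closed[OF g that]] by simp
    then have K: "carrier K = carrier (free_on R S)"
      by (simp add: K_simps(1) cong: conj_cong)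
    have "(\<lambda>x\<in>carrier (free_on R S). x) \<in> linear_maps R (free_on R S) K"
      by (rule linear_mapsI) (simp_all add: K K_simps(2,3) R.free_on_add_closed R.free_on_smult_closed)
    then have "(\<lambda>x\<in>carrier (free_on R S). x) \<in> linear_isos R (free_on R S) K"
      by (simp add: linear_isos_def K bij_betw_def)
    then show ?thesis
      by blast
  next
    case False
    have inj: "inj_on \<sigma> T"
    proof (rule inj_onI)
      fix t u assume tu: "t \<in> T" "u \<in> T" "\<sigma> t = \<sigma> u"
      then have "gen R t = gen R u"
        using sec by metis
      from fun_cong[OF this, of t] show "t = u"
        using False by (auto simp: gen_def split: if_splits)
    qed
    define push :: "('t \<Rightarrow> _) \<Rightarrow> 's \<Rightarrow> _" where
      "push = (\<lambda>w\<in>carrier (free_on R T). \<lambda>s. if s \<in> \<sigma> ` T then w (inv_into T \<sigma> s) else \<zero>\<^bsub>R\<^esub>)"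
    have push_in: "push w (\<sigma> t) = w t" if "w \<in> carrier (free_on R T)" "t \<in> T" for w t
      using that inj by (simp add: push_def)
    have push_out: "push w s = \<zero>\<^bsub>R\<^esub>" if "w \<in> carrier (free_on R T)" "s \<notin> \<sigma> ` T" for w s
      using that by (simp add: push_def)
    have push_cl: "push w \<in> carrier (free_on R S)" if w: "w \<in> carrier (free_on R T)" for w
    proof -
      have sub: "{s. push w s \<noteq> \<zero>\<^bsub>R\<^esub>} \<subseteq> \<sigma> ` {t. w t \<noteq> \<zero>\<^bsub>R\<^esub>}"
        using w inj by (auto simp: push_def)
      have fin: "finite (\<sigma> ` {t. w t \<noteq> \<zero>\<^bsub>R\<^esub>})" and sub': "\<sigma> ` {t. w t \<noteq> \<zero>\<^bsub>R\<^esub>} \<subseteq> S"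
        using w \<sigma> by (auto simp: free_on_carrier)
      have "push w s \<in> carrier R" for s
        using w by (auto simp: push_def free_on_carrier)
      then show ?thesis
        using finite_subset[OF sub fin] subset_trans[OF sub sub'] by (simp add: free_on_carrier)
    qed
    have push: "push \<in> linear_maps R (free_on R T) (free_on R S)"
      by (rule linear_mapsI)
         (use push_cl in \<open>auto simp: R.free_on_add_closed R.free_on_smult_closed\<close>,
          auto simp: push_def R.free_on_add_closed R.free_on_smult_closed)
    have push_gen: "push (gen R t) = gen R (\<sigma> t)" if t: "t \<in> T" for t
    proof
      fix s
      show "push (gen R t) s = gen R (\<sigma> t) s"
      proof (cases "s \<in> \<sigma> ` T")
        case True
        then obtain u where u: "u \<in> T" "s = \<sigma> u"
          by blast
        then show ?thesis
          using t unfolding u(2) push_in[OF R.gen_closed[OF t] u(1)]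
          by (auto simp: gen_def inj_on_eq_iff[OF inj])
      next
        case False
        then show ?thesis
          using t unfolding push_out[OF R.gen_closed[OF t] False] by (auto simp: gen_def)
      qed
    qed
    have g_push: "g (push w) = w" if w: "w \<in> carrier (free_on R T)" for w
    proof -
      have "compose (carrier (free_on R T)) g push \<in> linear_maps R (free_on R T) (free_on R T)"
        by (rule linear_maps_comp[OF g push T.left_module_axioms])
      moreover have "(\<lambda>x\<in>carrier (free_on R T). x) \<in> linear_maps R (free_on R T) (free_on R T)"
        by (rule linear_mapsI) (simp_all add: R.free_on_add_closed R.free_on_smult_closed)
      ultimately have "compose (carrier (free_on R T)) g push w = (\<lambda>x\<in>carrier (free_on R T). x) w"
        by (rule R.linear_maps_agree[OF _ _ T.left_module_axioms _ w])
           (simp add: compose_def R.gen_closed push_gen sec)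
      then show ?thesis
        using w by (simp add: compose_def)
    qed
    define S' where "S' = S - \<sigma> ` T"
    have S': "u \<in> carrier (free_on R S)" if "u \<in> carrier (free_on R S')" for u
      using that by (auto simp: free_on_carrier S'_def)
    have S'_out: "u s = \<zero>\<^bsub>R\<^esub>" if "u \<in> carrier (free_on R S')" "s \<notin> S'" for u s
      using that by (auto simp: free_on_carrier)
    define \<Phi> where "\<Phi> = (\<lambda>u\<in>carrier (free_on R S'). \<lambda>s. u s \<ominus>\<^bsub>R\<^esub> push (g u) s)"
    have \<Phi>_apply: "\<Phi> u = (\<lambda>s. u s \<ominus>\<^bsub>R\<^esub> push (g u) s)" if "u \<in> carrier (free_on R S')" for u
      using that by (simp add: \<Phi>_def)
    have \<Phi>_diff: "\<Phi> u = u \<ominus>\<^bsub>free_on R S\<^esub> push (g u)" if "u \<in> carrier (free_on R S')" for u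
      using that S' by (simp add: \<Phi>_def R.free_on_minus push_cl linear_maps_closed[OF g])
    have vals: "u s \<in> carrier R" "push (g u) s \<in> carrier R" "g u t \<in> carrier R"
      if "u \<in> carrier (free_on R S)" for u s t
      using that push_cl[OF linear_maps_closed[OF g that]] linear_maps_closed[OF g that]
      by (auto simp: free_on_carrier)
    have \<Phi>_in: "\<Phi> u (\<sigma> t) = \<ominus>\<^bsub>R\<^esub> g u t" if "u \<in> carrier (free_on R S')" "t \<in> T" for u t
      using that S' vals[OF S'[OF that(1)]] S'_out[OF that(1), of "\<sigma> t"]
      by (simp add: \<Phi>_def push_in linear_maps_closed[OF g] S'_def a_minus_def)
    have \<Phi>_out: "\<Phi> u s = u s" if "u \<in> carrier (free_on R S')" "s \<notin> \<sigma> ` T" for u s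
      using that S' vals[OF S'[OF that(1)]] by (simp add: \<Phi>_def push_out linear_maps_closed[OF g] a_minus_def)
    have lin: "\<Phi> \<in> linear_maps R (free_on R S') K"
    proof (rule linear_mapsI)
      fix u assume u: "u \<in> carrier (free_on R S')"
      have gu: "g u \<in> carrier (free_on R T)" "push (g u) \<in> carrier (free_on R S)"
        using S'[OF u] by (simp_all add: linear_maps_closed[OF g] push_cl)
      have "g (\<Phi> u) = g u \<ominus>\<^bsub>free_on R T\<^esub> g (push (g u))"
        unfolding \<Phi>_diff[OF u]
        by (rule linear_maps_diff[OF g S.left_module_axioms T.left_module_axioms S'[OF u] gu(2)])
      also have "\<dots> = \<zero>\<^bsub>free_on R T\<^esub>"
        unfolding g_push[OF gu(1)] T.M.minus_eq by (rule T.M.r_neg[OF gu(1)])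
      finally have "g (\<Phi> u) = (\<lambda>_. \<zero>\<^bsub>R\<^esub>)"
        by (simp only: free_on_simps)
      moreover have "\<Phi> u \<in> carrier (free_on R S)"
        unfolding \<Phi>_diff[OF u] by (rule S.M.minus_closed[OF S'[OF u] gu(2)])
      ultimately show "\<Phi> u \<in> carrier K"
        by (simp only: K_simps mem_Collect_eq)
      fix v assume v: "v \<in> carrier (free_on R S')"
      have uv: "(\<lambda>s. u s \<oplus>\<^bsub>R\<^esub> v s) \<in> carrier (free_on R S')"
        using u v by (rule R.free_on_add_closed)
      have "g (\<lambda>s. u s \<oplus>\<^bsub>R\<^esub> v s) = (\<lambda>t. g u t \<oplus>\<^bsub>R\<^esub> g v t)"
        using linear_maps_add[OF g S'[OF u] S'[OF v]] by simp
      moreover have "push (\<lambda>t. g u t \<oplus>\<^bsub>R\<^esub> g v t) = (\<lambda>s. push (g u) s \<oplus>\<^bsub>R\<^esub> push (g v) s)"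
        using linear_maps_add[OF push gu(1) linear_maps_closed[OF g S'[OF v]]] by simp
      ultimately show "\<Phi> (u \<oplus>\<^bsub>free_on R S'\<^esub> v) = \<Phi> u \<oplus>\<^bsub>K\<^esub> \<Phi> v"
        unfolding K_simps free_on_simps \<Phi>_apply[OF u] \<Phi>_apply[OF v] \<Phi>_apply[OF uv]
        by (auto intro!: R.add_diff_add vals S' u v)
    next
      fix a u assume a: "a \<in> carrier R" and u: "u \<in> carrier (free_on R S')"
      have au: "(\<lambda>s. a \<otimes>\<^bsub>R\<^esub> u s) \<in> carrier (free_on R S')"
        using u a by (rule R.free_on_smult_closed)
      have "g (\<lambda>s. a \<otimes>\<^bsub>R\<^esub> u s) = (\<lambda>t. a \<otimes>\<^bsub>R\<^esub> g u t)"
        using linear_maps_smult[OF g a S'[OF u]] by simp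
      moreover have "push (\<lambda>t. a \<otimes>\<^bsub>R\<^esub> g u t) = (\<lambda>s. a \<otimes>\<^bsub>R\<^esub> push (g u) s)"
        using linear_maps_smult[OF push a linear_maps_closed[OF g S'[OF u]]] by simp
      ultimately show "\<Phi> (a \<odot>\<^bsub>free_on R S'\<^esub> u) = a \<odot>\<^bsub>K\<^esub> \<Phi> u"
        unfolding K_simps free_on_simps \<Phi>_apply[OF u] \<Phi>_apply[OF au]
        using a vals[OF S'[OF u]] by (simp add: a_minus_def R.r_distr R.r_minus)
    qed (simp add: \<Phi>_def)
    have "inj_on \<Phi> (carrier (free_on R S'))"
    proof (rule inj_onI, rule ext)
      fix u v s assume uv: "u \<in> carrier (free_on R S')" "v \<in> carrier (free_on R S')" "\<Phi> u = \<Phi> v"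
      show "u s = v s"
      proof (cases "s \<in> \<sigma> ` T")
        case True
        then show ?thesis
          using S'_out[OF uv(1)] S'_out[OF uv(2)] by (simp add: S'_def)
      next
        case False
        then show ?thesis
          using \<Phi>_out[OF uv(1)] \<Phi>_out[OF uv(2)] uv(3) by metis
      qed
    qed
    moreover have "v \<in> \<Phi> ` carrier (free_on R S')" if v: "v \<in> carrier K" for v
    proof -
      have vS: "v \<in> carrier (free_on R S)" and gv: "g v = (\<lambda>_. \<zero>\<^bsub>R\<^esub>)"
        using v by (auto simp: K_simps)
      \<comment> \<open>The preimage of \<open>v\<close> is its part outside \<open>\<sigma> ` T\<close>. The rest of \<open>v\<close> is \<open>push w\<close>, and \<open>g v = 0\<close> gives
        \<open>g u = - w\<close>.\<close>
      define u where "u = (\<lambda>s. if s \<in> \<sigma> ` T then \<zero>\<^bsub>R\<^esub> else v s)"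
      define w where "w = (\<lambda>t. if t \<in> T then v (\<sigma> t) else \<zero>\<^bsub>R\<^esub>)"
      have "{s. u s \<noteq> \<zero>\<^bsub>R\<^esub>} \<subseteq> {s. v s \<noteq> \<zero>\<^bsub>R\<^esub>}"
        by (auto simp: u_def)
      from finite_subset[OF this] have u: "u \<in> carrier (free_on R S')"
        using vS by (auto simp: free_on_carrier u_def S'_def)
      have sub: "\<sigma> ` {t. w t \<noteq> \<zero>\<^bsub>R\<^esub>} \<subseteq> {s. v s \<noteq> \<zero>\<^bsub>R\<^esub>}" and injw: "inj_on \<sigma> {t. w t \<noteq> \<zero>\<^bsub>R\<^esub>}"
        by (auto simp: w_def intro: inj_on_subset[OF inj])
      have "finite {t. w t \<noteq> \<zero>\<^bsub>R\<^esub>}"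
        using vS by (intro finite_imageD[OF finite_subset[OF sub] injw]) (simp add: free_on_carrier)
      then have w: "w \<in> carrier (free_on R T)"
        using vS by (auto simp: free_on_carrier w_def)
      have "v = (\<lambda>s. u s \<oplus>\<^bsub>R\<^esub> push w s)"
      proof
        fix s
        have "v s \<in> carrier R"
          using vS by (simp add: free_on_carrier)
        then show "v s = u s \<oplus>\<^bsub>R\<^esub> push w s"
          using push_in[OF w] push_out[OF w] by (auto simp: u_def w_def)
      qed
      then have "g v = g u \<oplus>\<^bsub>free_on R T\<^esub> w"
        using linear_maps_add[OF g S'[OF u] push_cl[OF w]] by (simp add: g_push[OF w])
      then have "(\<lambda>t. g u t \<oplus>\<^bsub>R\<^esub> w t) = (\<lambda>_. \<zero>\<^bsub>R\<^esub>)"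
        by (simp only: gv free_on_simps)
      then have sum: "g u t \<oplus>\<^bsub>R\<^esub> w t = \<zero>\<^bsub>R\<^esub>" for t
        by (rule fun_cong)
      have "\<Phi> u = v"
      proof
        fix s
        show "\<Phi> u s = v s"
        proof (cases "s \<in> \<sigma> ` T")
          case True
          then obtain t where t: "t \<in> T" "s = \<sigma> t"
            by blast
          have "w t \<in> carrier R"
            using w by (simp add: free_on_carrier)
          then have "\<ominus>\<^bsub>R\<^esub> g u t = w t"
            using sum[of t] vals(3)[OF S'[OF u], of t] by (metis R.minus_equality R.minus_minus)
          then show ?thesis
            using t by (simp add: \<Phi>_in[OF u] w_def)
        next
          case False
          then show ?thesis
            unfolding \<Phi>_out[OF u False] by (simp add: u_def)
        qed
      qed
      with u show ?thesis
        by blast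
    qed
    moreover have "\<Phi> ` carrier (free_on R S') \<subseteq> carrier K"
      by (rule image_subsetI) (rule linear_maps_closed[OF lin])
    ultimately have "bij_betw \<Phi> (carrier (free_on R S')) (carrier K)"
      by (rule bij_betwI_inj_surj)
    with lin show ?thesis
      unfolding linear_isos_def by blast
  qed
qed

section \<open>Quotient modules\<close>

definition is_submodule :: "('r, 'k) ring_scheme \<Rightarrow> ('r, 'a, 'm) module_scheme \<Rightarrow> 'a set \<Rightarrow> bool" where
  "is_submodule R M N \<longleftrightarrow> N \<subseteq> carrier M \<and> \<zero>\<^bsub>M\<^esub> \<in> N \<and> (\<forall>x\<in>N. \<forall>y\<in>N. x \<oplus>\<^bsub>M\<^esub> y \<in> N) \<and>
     (\<forall>a\<in>carrier R. \<forall>x\<in>N. a \<odot>\<^bsub>M\<^esub> x \<in> N)"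

lemma is_submodule_image:
  assumes h: "h \<in> linear_maps R M N" and M: "left_module R M" and N: "left_module R N"
  shows "is_submodule R N (h ` carrier M)"
proof -
  interpret M: left_module R M by fact
  have "h ` carrier M \<subseteq> carrier N"
    using linear_maps_closed[OF h] by auto
  moreover have "\<zero>\<^bsub>N\<^esub> \<in> h ` carrier M"
    using imageI[OF M.M.zero_closed, of h] by (simp only: linear_maps_zero[OF h M N])
  moreover have "h x \<oplus>\<^bsub>N\<^esub> h y \<in> h ` carrier M" if "x \<in> carrier M" "y \<in> carrier M" for x y
    using imageI[OF M.M.a_closed[OF that], of h] by (simp only: linear_maps_add[OF h that])
  moreover have "a \<odot>\<^bsub>N\<^esub> h x \<in> h ` carrier M" if "a \<in> carrier R" "x \<in> carrier M" for a x
    using imageI[OF M.smult_closed[OF that], of h] by (simp only: linear_maps_smult[OF h that])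
  ultimately show ?thesis
    by (simp add: is_submodule_def)
qed

lemma (in left_module) submodule_coset_mem:
  assumes N: "is_submodule R M N" and x: "x \<in> carrier M"
  shows "z \<in> N +>\<^bsub>M\<^esub> x \<longleftrightarrow> z \<in> carrier M \<and> z \<ominus>\<^bsub>M\<^esub> x \<in> N"
proof -
  have sub: "N \<subseteq> carrier M"
    using N by (simp add: is_submodule_def)
  show ?thesis
  proof
    assume "z \<in> N +>\<^bsub>M\<^esub> x"
    then obtain n where n: "n \<in> N" "z = n \<oplus>\<^bsub>M\<^esub> x"
      by (auto simp: a_r_coset_def')
    then have "z \<ominus>\<^bsub>M\<^esub> x = n"
      using x sub by (simp add: a_minus_def M.a_assoc M.r_neg subset_iff)
    then show "z \<in> carrier M \<and> z \<ominus>\<^bsub>M\<^esub> x \<in> N"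
      using n x sub by auto
  next
    assume z: "z \<in> carrier M \<and> z \<ominus>\<^bsub>M\<^esub> x \<in> N"
    then have "z = (z \<ominus>\<^bsub>M\<^esub> x) \<oplus>\<^bsub>M\<^esub> x"
      using x by (simp add: a_minus_def M.a_assoc M.l_neg)
    then show "z \<in> N +>\<^bsub>M\<^esub> x"
      using z by (auto simp: a_r_coset_def')
  qed
qed

lemma (in left_module) submodule_abelian_subgroup:
  assumes N: "is_submodule R M N"
  shows "abelian_subgroup N M"
proof (rule abelian_subgroupI3[OF additive_subgroup.intro M.abelian_group_axioms], rule M.add.subgroupI)
  show "N \<subseteq> carrier M" "N \<noteq> {}"
    using N by (auto simp: is_submodule_def)
  show "a \<in> N \<Longrightarrow> b \<in> N \<Longrightarrow> a \<oplus>\<^bsub>M\<^esub> b \<in> N" for a b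
    using N by (simp add: is_submodule_def)
  show "\<ominus>\<^bsub>M\<^esub> a \<in> N" if "a \<in> N" for a
  proof -
    have "(\<ominus>\<^bsub>R\<^esub> \<one>\<^bsub>R\<^esub>) \<odot>\<^bsub>M\<^esub> a \<in> N" "a \<in> carrier M"
      using N that by (auto simp: is_submodule_def)
    then show ?thesis
      by (simp add: smult_l_minus_one)
  qed
qed

lemma (in left_module) submodule_coset_eq:
  assumes N: "is_submodule R M N" and x: "x \<in> carrier M" and y: "y \<in> carrier M"
  shows "N +>\<^bsub>M\<^esub> x = N +>\<^bsub>M\<^esub> y \<longleftrightarrow> x \<ominus>\<^bsub>M\<^esub> y \<in> N"
proof
  interpret N: abelian_subgroup N M
    by (rule submodule_abelian_subgroup[OF N])
  assume "N +>\<^bsub>M\<^esub> x = N +>\<^bsub>M\<^esub> y"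
  then show "x \<ominus>\<^bsub>M\<^esub> y \<in> N"
    using N.a_rcos_self[OF x] submodule_coset_mem[OF N y] by simp
next
  interpret N: abelian_subgroup N M
    by (rule submodule_abelian_subgroup[OF N])
  assume xy: "x \<ominus>\<^bsub>M\<^esub> y \<in> N"
  have telescope: "(z \<ominus>\<^bsub>M\<^esub> x) \<oplus>\<^bsub>M\<^esub> (x \<ominus>\<^bsub>M\<^esub> y) = z \<ominus>\<^bsub>M\<^esub> y"
    if "x \<in> carrier M" "y \<in> carrier M" "z \<in> carrier M" for x y z
    using that by (simp add: a_minus_def M.a_assoc M.r_neg1)
  have "z \<ominus>\<^bsub>M\<^esub> x \<in> N \<longleftrightarrow> z \<ominus>\<^bsub>M\<^esub> y \<in> N" if z: "z \<in> carrier M" for z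
  proof
    assume "z \<ominus>\<^bsub>M\<^esub> x \<in> N"
    then have "(z \<ominus>\<^bsub>M\<^esub> x) \<oplus>\<^bsub>M\<^esub> (x \<ominus>\<^bsub>M\<^esub> y) \<in> N"
      using xy by (rule N.a_closed)
    then show "z \<ominus>\<^bsub>M\<^esub> y \<in> N"
      by (simp only: telescope[OF x y z])
  next
    assume "z \<ominus>\<^bsub>M\<^esub> y \<in> N"
    moreover have "y \<ominus>\<^bsub>M\<^esub> x \<in> N"
      using N.a_inv_closed[OF xy] x y by (simp add: a_minus_def M.minus_add M.a_comm)
    ultimately have "(z \<ominus>\<^bsub>M\<^esub> y) \<oplus>\<^bsub>M\<^esub> (y \<ominus>\<^bsub>M\<^esub> x) \<in> N"
      by (rule N.a_closed)
    then show "z \<ominus>\<^bsub>M\<^esub> x \<in> N"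
      by (simp only: telescope[OF y x z])
  qed
  then show "N +>\<^bsub>M\<^esub> x = N +>\<^bsub>M\<^esub> y"
    unfolding set_eq_iff submodule_coset_mem[OF N x] submodule_coset_mem[OF N y] by (simp cong: conj_cong)
qed

text \<open>Both the scalar multiplication of a quotient module and the map induced on quotients are defined as
  unions over all representatives; this computes them from a single one.\<close>

lemma (in left_module) Union_over_coset:
  assumes "is_submodule R M N" "x \<in> carrier M"
    and "\<And>z. z \<in> carrier M \<Longrightarrow> z \<ominus>\<^bsub>M\<^esub> x \<in> N \<Longrightarrow> F z = F x"
  shows "(\<Union>z\<in>N +>\<^bsub>M\<^esub> x. F z) = F x"
proof -
  interpret N: abelian_subgroup N M
    by (rule submodule_abelian_subgroup[OF assms(1)])
  show ?thesis
  proof (intro equalityI UN_least)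
    show "F z \<subseteq> F x" if "z \<in> N +>\<^bsub>M\<^esub> x" for z
      using assms(3)[of z] that by (simp add: submodule_coset_mem[OF assms(1,2)])
    show "F x \<subseteq> (\<Union>z\<in>N +>\<^bsub>M\<^esub> x. F z)"
      by (rule UN_upper[OF N.a_rcos_self[OF assms(2)]])
  qed
qed

lemma (in left_module) smult_diff:
  assumes a: "a \<in> carrier R" and z: "z \<in> carrier M" and x: "x \<in> carrier M"
  shows "a \<odot>\<^bsub>M\<^esub> (z \<ominus>\<^bsub>M\<^esub> x) = a \<odot>\<^bsub>M\<^esub> z \<ominus>\<^bsub>M\<^esub> a \<odot>\<^bsub>M\<^esub> x"
proof -
  have "z = (z \<ominus>\<^bsub>M\<^esub> x) \<oplus>\<^bsub>M\<^esub> x"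
    using x z by (simp add: a_minus_def M.a_assoc M.l_neg)
  then have "a \<odot>\<^bsub>M\<^esub> z = a \<odot>\<^bsub>M\<^esub> (z \<ominus>\<^bsub>M\<^esub> x) \<oplus>\<^bsub>M\<^esub> a \<odot>\<^bsub>M\<^esub> x"
    using smult_r_distr[OF a M.minus_closed[OF z x] x] by simp
  then show ?thesis
    using smult_closed[OF a x] smult_closed[OF a M.minus_closed[OF z x]]
    by (simp add: M.minus_eq M.a_assoc M.r_neg)
qed

lemma (in left_module) coset_smult:
  assumes N: "is_submodule R M N" and a: "a \<in> carrier R" and x: "x \<in> carrier M"
  shows "(\<Union>z\<in>N +>\<^bsub>M\<^esub> x. N +>\<^bsub>M\<^esub> (a \<odot>\<^bsub>M\<^esub> z)) = N +>\<^bsub>M\<^esub> (a \<odot>\<^bsub>M\<^esub> x)"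
proof (rule Union_over_coset[OF N x])
  fix z assume z: "z \<in> carrier M" "z \<ominus>\<^bsub>M\<^esub> x \<in> N"
  have "a \<odot>\<^bsub>M\<^esub> z \<ominus>\<^bsub>M\<^esub> a \<odot>\<^bsub>M\<^esub> x = a \<odot>\<^bsub>M\<^esub> (z \<ominus>\<^bsub>M\<^esub> x)"
    by (rule smult_diff[OF a z(1) x, symmetric])
  also have "\<dots> \<in> N"
    using N z(2) a by (simp add: is_submodule_def)
  finally show "N +>\<^bsub>M\<^esub> (a \<odot>\<^bsub>M\<^esub> z) = N +>\<^bsub>M\<^esub> (a \<odot>\<^bsub>M\<^esub> x)"
    by (simp add: submodule_coset_eq[OF N smult_closed[OF a z(1)] smult_closed[OF a x]])
qed

lemma quotient_module_simps:
  "carrier (quotient_module M N) = (\<lambda>x. N +>\<^bsub>M\<^esub> x) ` carrier M"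
  "C \<oplus>\<^bsub>quotient_module M N\<^esub> D = C <+>\<^bsub>M\<^esub> D"
  "a \<odot>\<^bsub>quotient_module M N\<^esub> C = (\<Union>x\<in>C. N +>\<^bsub>M\<^esub> (a \<odot>\<^bsub>M\<^esub> x))"
  "\<zero>\<^bsub>quotient_module M N\<^esub> = N"
  by (auto simp: quotient_module_def A_RCOSETS_def')

lemma quotient_map_iso:
  assumes M: "left_module R M" and M': "left_module R M'"
    and N: "is_submodule R M N" and N': "is_submodule R M' N'"
    and \<phi>: "restrict \<phi> (carrier M) \<in> linear_maps R M M'"
    and onto: "\<And>y. y \<in> carrier M' \<Longrightarrow> \<exists>x\<in>carrier M. \<phi> x = y"
    and iff: "\<And>x. x \<in> carrier M \<Longrightarrow> \<phi> x \<in> N' \<longleftrightarrow> x \<in> N"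
  shows "(\<lambda>C\<in>carrier (quotient_module M N). \<Union>x\<in>C. N' +>\<^bsub>M'\<^esub> \<phi> x)
    \<in> linear_isos R (quotient_module M N) (quotient_module M' N')" (is "?\<psi> \<in> _")
proof -
  interpret M: left_module R M by fact
  interpret M': left_module R M' by fact
  interpret N: abelian_subgroup N M
    by (rule M.submodule_abelian_subgroup[OF N])
  interpret N': abelian_subgroup N' M'
    by (rule M'.submodule_abelian_subgroup[OF N'])
  have \<phi>_cl: "\<phi> x \<in> carrier M'" if "x \<in> carrier M" for x
    using linear_maps_closed[OF \<phi> that] that by simp
  have \<phi>_add: "\<phi> (x \<oplus>\<^bsub>M\<^esub> y) = \<phi> x \<oplus>\<^bsub>M'\<^esub> \<phi> y" if "x \<in> carrier M" "y \<in> carrier M" for x y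
    using linear_maps_add[OF \<phi> that] that by simp
  have \<phi>_smult: "\<phi> (a \<odot>\<^bsub>M\<^esub> x) = a \<odot>\<^bsub>M'\<^esub> \<phi> x" if "a \<in> carrier R" "x \<in> carrier M" for a x
    using linear_maps_smult[OF \<phi> that] M.smult_closed[OF that] that by simp
  have \<phi>_diff: "\<phi> (x \<ominus>\<^bsub>M\<^esub> y) = \<phi> x \<ominus>\<^bsub>M'\<^esub> \<phi> y" if "x \<in> carrier M" "y \<in> carrier M" for x y
    using linear_maps_diff[OF \<phi> M M' that] M.M.minus_closed[OF that] that by simp
  have \<psi>: "?\<psi> (N +>\<^bsub>M\<^esub> x) = N' +>\<^bsub>M'\<^esub> \<phi> x" if x: "x \<in> carrier M" for x
  proof -
    have "(\<Union>z\<in>N +>\<^bsub>M\<^esub> x. N' +>\<^bsub>M'\<^esub> \<phi> z) = N' +>\<^bsub>M'\<^esub> \<phi> x"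
    proof (rule M.Union_over_coset[OF N x])
      fix z assume z: "z \<in> carrier M" "z \<ominus>\<^bsub>M\<^esub> x \<in> N"
      have "\<phi> z \<ominus>\<^bsub>M'\<^esub> \<phi> x \<in> N'"
        unfolding \<phi>_diff[OF z(1) x, symmetric] iff[OF M.M.minus_closed[OF z(1) x]] by (rule z(2))
      then show "N' +>\<^bsub>M'\<^esub> \<phi> z = N' +>\<^bsub>M'\<^esub> \<phi> x"
        by (simp only: M'.submodule_coset_eq[OF N' \<phi>_cl[OF z(1)] \<phi>_cl[OF x]])
    qed
    with x show ?thesis
      by (simp add: quotient_module_simps)
  qed
  have lin: "?\<psi> \<in> linear_maps R (quotient_module M N) (quotient_module M' N')"
  proof (rule linear_mapsI)
    fix C assume "C \<in> carrier (quotient_module M N)"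
    then obtain x where x: "x \<in> carrier M" and C: "C = N +>\<^bsub>M\<^esub> x"
      by (auto simp: quotient_module_simps)
    show "?\<psi> C \<in> carrier (quotient_module M' N')"
      unfolding C \<psi>[OF x] unfolding quotient_module_simps by (rule imageI[OF \<phi>_cl[OF x]])
    fix D assume "D \<in> carrier (quotient_module M N)"
    then obtain y where y: "y \<in> carrier M" and D: "D = N +>\<^bsub>M\<^esub> y"
      by (auto simp: quotient_module_simps)
    show "?\<psi> (C \<oplus>\<^bsub>quotient_module M N\<^esub> D) = ?\<psi> C \<oplus>\<^bsub>quotient_module M' N'\<^esub> ?\<psi> D"
      unfolding C D quotient_module_simps(2) N.a_rcos_sum[OF x y] \<psi>[OF x] \<psi>[OF y] \<psi>[OF M.M.a_closed[OF x y]]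
        N'.a_rcos_sum[OF \<phi>_cl[OF x] \<phi>_cl[OF y]] \<phi>_add[OF x y] ..
  next
    fix a C assume a: "a \<in> carrier R" and "C \<in> carrier (quotient_module M N)"
    then obtain x where x: "x \<in> carrier M" and C: "C = N +>\<^bsub>M\<^esub> x"
      by (auto simp: quotient_module_simps)
    show "?\<psi> (a \<odot>\<^bsub>quotient_module M N\<^esub> C) = a \<odot>\<^bsub>quotient_module M' N'\<^esub> ?\<psi> C"
      unfolding C quotient_module_simps(3) M.coset_smult[OF N a x] \<psi>[OF x] \<psi>[OF M.smult_closed[OF a x]]
        M'.coset_smult[OF N' a \<phi>_cl[OF x]] \<phi>_smult[OF a x] ..
  qed simp
  have "inj_on ?\<psi> (carrier (quotient_module M N))"
  proof (rule inj_onI)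
    fix C D
    assume "C \<in> carrier (quotient_module M N)" "D \<in> carrier (quotient_module M N)" and eq: "?\<psi> C = ?\<psi> D"
    then obtain x y where x: "x \<in> carrier M" "C = N +>\<^bsub>M\<^esub> x" and y: "y \<in> carrier M" "D = N +>\<^bsub>M\<^esub> y"
      unfolding quotient_module_simps by blast
    have "\<phi> (x \<ominus>\<^bsub>M\<^esub> y) \<in> N'"
      using eq unfolding x(2) y(2) \<psi>[OF x(1)] \<psi>[OF y(1)]
        M'.submodule_coset_eq[OF N' \<phi>_cl[OF x(1)] \<phi>_cl[OF y(1)]] \<phi>_diff[OF x(1) y(1)] .
    then show "C = D"
      unfolding x(2) y(2) M.submodule_coset_eq[OF N x(1) y(1)] iff[OF M.M.minus_closed[OF x(1) y(1)]] .
  qed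
  moreover have "D \<in> ?\<psi> ` carrier (quotient_module M N)" if D: "D \<in> carrier (quotient_module M' N')" for D
  proof -
    obtain y where y: "y \<in> carrier M'" "D = N' +>\<^bsub>M'\<^esub> y"
      using D by (auto simp: quotient_module_simps)
    obtain x where x: "x \<in> carrier M" "\<phi> x = y"
      using onto[OF y(1)] by blast
    have "N +>\<^bsub>M\<^esub> x \<in> carrier (quotient_module M N)"
      using x(1) by (simp add: quotient_module_simps)
    then show ?thesis
      unfolding y(2) x(2)[symmetric] \<psi>[OF x(1), symmetric] by (rule imageI)
  qed
  moreover have "?\<psi> ` carrier (quotient_module M N) \<subseteq> carrier (quotient_module M' N')"
    by (rule image_subsetI) (rule linear_maps_closed[OF lin])
  ultimately have "bij_betw ?\<psi> (carrier (quotient_module M N)) (carrier (quotient_module M' N'))"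
    by (rule bij_betwI_inj_surj)
  with lin show ?thesis
    by (simp only: linear_isos_def mem_Collect_eq simp_thms)
qed

lemma (in abelian_group) right_minus_eq:
  assumes "a \<in> carrier G" "b \<in> carrier G"
  shows "a \<ominus> b = \<zero> \<longleftrightarrow> a = b"
proof
  assume eq: "a \<ominus> b = \<zero>"
  have "a = (a \<ominus> b) \<oplus> b"
    using assms by (simp add: a_minus_def a_assoc l_neg)
  also have "\<dots> = b"
    unfolding eq using assms(2) by simp
  finally show "a = b" .
next
  assume "a = b"
  then show "a \<ominus> b = \<zero>"
    using assms(2) by (simp add: a_minus_def r_neg)
qed

text \<open>The inverse of the isomorphism of the first isomorphism theorem: a coset of the kernel is a fibre. The
  map starts from \<open>L\<close> because freeness and the module axioms are carried from \<open>L\<close> to the quotient.\<close>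

lemma fibre_map_iso:
  assumes N: "left_module R N" and L: "left_module R L"
    and g: "g \<in> linear_maps R N L" and onto: "\<And>w. w \<in> carrier L \<Longrightarrow> \<exists>x\<in>carrier N. g x = w"
    and I: "I = {x \<in> carrier N. g x = \<zero>\<^bsub>L\<^esub>}"
  shows "(\<lambda>w\<in>carrier L. {x \<in> carrier N. g x = w}) \<in> linear_isos R L (quotient_module N I)"
    (is "?\<Phi> \<in> _")
proof -
  interpret N: left_module R N by fact
  interpret L: left_module R L by fact
  have I_sub: "is_submodule R N I"
    by (auto simp: is_submodule_def I L.smult_r_null N.smult_closed linear_maps_zero[OF g N L]
        linear_maps_add[OF g] linear_maps_smult[OF g])
  interpret I: abelian_subgroup I N
    by (rule N.submodule_abelian_subgroup[OF I_sub])
  have \<Phi>: "?\<Phi> (g x) = I +>\<^bsub>N\<^esub> x" if x: "x \<in> carrier N" for x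
  proof -
    have "g z = g x \<longleftrightarrow> z \<ominus>\<^bsub>N\<^esub> x \<in> I" if z: "z \<in> carrier N" for z
      unfolding I mem_Collect_eq linear_maps_diff[OF g N L z x]
        L.M.right_minus_eq[OF linear_maps_closed[OF g z] linear_maps_closed[OF g x]]
      by (simp only: N.M.minus_closed[OF z x] simp_thms)
    then have "{z \<in> carrier N. g z = g x} = I +>\<^bsub>N\<^esub> x"
      unfolding set_eq_iff mem_Collect_eq N.submodule_coset_mem[OF I_sub x] by (simp cong: conj_cong)
    then show ?thesis
      by (simp only: restrict_apply' linear_maps_closed[OF g x])
  qed
  have lin: "?\<Phi> \<in> linear_maps R L (quotient_module N I)"
  proof (rule linear_mapsI)
    fix w assume "w \<in> carrier L"
    then obtain x where x: "x \<in> carrier N" and w: "w = g x"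
      using onto by blast
    show "?\<Phi> w \<in> carrier (quotient_module N I)"
      unfolding w \<Phi>[OF x] unfolding quotient_module_simps by (rule imageI[OF x])
    fix v assume "v \<in> carrier L"
    then obtain y where y: "y \<in> carrier N" and v: "v = g y"
      using onto by blast
    show "?\<Phi> (w \<oplus>\<^bsub>L\<^esub> v) = ?\<Phi> w \<oplus>\<^bsub>quotient_module N I\<^esub> ?\<Phi> v"
      unfolding w v quotient_module_simps(2) linear_maps_add[OF g x y, symmetric]
        \<Phi>[OF x] \<Phi>[OF y] \<Phi>[OF N.M.a_closed[OF x y]] I.a_rcos_sum[OF x y] ..
  next
    fix a w assume a: "a \<in> carrier R" and "w \<in> carrier L"
    then obtain x where x: "x \<in> carrier N" and w: "w = g x"
      using onto by blast
    show "?\<Phi> (a \<odot>\<^bsub>L\<^esub> w) = a \<odot>\<^bsub>quotient_module N I\<^esub> ?\<Phi> w"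
      unfolding w quotient_module_simps(3) linear_maps_smult[OF g a x, symmetric]
        \<Phi>[OF x] \<Phi>[OF N.smult_closed[OF a x]] N.coset_smult[OF I_sub a x] ..
  qed simp
  have "inj_on ?\<Phi> (carrier L)"
  proof (rule inj_onI)
    fix v w assume vw: "v \<in> carrier L" "w \<in> carrier L" "?\<Phi> v = ?\<Phi> w"
    obtain x where "x \<in> carrier N" "g x = v"
      using onto[OF vw(1)] by blast
    then have "x \<in> ?\<Phi> w"
      using vw(1) unfolding vw(3)[symmetric] by simp
    then show "v = w"
      using vw(2) \<open>g x = v\<close> by simp
  qed
  moreover have "C \<in> ?\<Phi> ` carrier L" if C: "C \<in> carrier (quotient_module N I)" for C
  proof -
    obtain x where x: "x \<in> carrier N" "C = I +>\<^bsub>N\<^esub> x"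
      using C unfolding quotient_module_simps by blast
    show ?thesis
      unfolding x(2) \<Phi>[OF x(1), symmetric] by (rule imageI[OF linear_maps_closed[OF g x(1)]])
  qed
  moreover have "?\<Phi> ` carrier L \<subseteq> carrier (quotient_module N I)"
    by (rule image_subsetI) (rule linear_maps_closed[OF lin])
  ultimately have "bij_betw ?\<Phi> (carrier L) (carrier (quotient_module N I))"
    by (rule bij_betwI_inj_surj)
  with lin show ?thesis
    by (simp only: linear_isos_def mem_Collect_eq simp_thms)
qed

section \<open>Isomorphisms on the first derived limit\<close>

lemma product_module_simps:
  "x \<in> carrier (product_module X) \<longleftrightarrow> (\<forall>n. x n \<in> carrier (obj X n))"
  "\<zero>\<^bsub>product_module X\<^esub> = (\<lambda>n. \<zero>\<^bsub>obj X n\<^esub>)"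
  "x \<oplus>\<^bsub>product_module X\<^esub> y = (\<lambda>n. x n \<oplus>\<^bsub>obj X n\<^esub> y n)"
  "a \<odot>\<^bsub>product_module X\<^esub> x = (\<lambda>n. a \<odot>\<^bsub>obj X n\<^esub> x n)"
  by (simp_all add: product_module_def)

lemma inverse_sequence_obj: "inverse_sequence R X \<Longrightarrow> left_module R (obj X n)"
  and inverse_sequence_smap:
    "inverse_sequence R X \<Longrightarrow> smap X (Suc n) \<in> linear_maps R (obj X (Suc n)) (obj X n)"
  by (auto simp: inverse_sequence_def dest: spec[of _ "Suc n"])

lemma inv_seq_hom_linear: "f \<in> inv_seq_hom R X Y \<Longrightarrow> f n \<in> linear_maps R (obj X n) (obj Y n)"
  and inv_seq_hom_smap: "f \<in> inv_seq_hom R X Y \<Longrightarrow> x \<in> carrier (obj X (Suc n)) \<Longrightarrow>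
    f n (smap X (Suc n) x) = smap Y (Suc n) (f (Suc n) x)"
  by (auto simp: inv_seq_hom_def dest: spec[of _ "Suc n"])

lemma product_left_module:
  assumes "inverse_sequence R X"
  shows "left_module R (product_module X)"
proof -
  have X: "left_module R (obj X n)" for n
    using assms by (rule inverse_sequence_obj)
  have G: "abelian_group (obj X n)" for n
    using X by (simp add: left_module_def)
  have R: "ring R"
    using X[of 0] by (simp add: left_module_def)
  show ?thesis
  proof (intro left_module.intro left_module_axioms.intro R)
    show "abelian_group (product_module X)"
    proof (rule abelian_groupI)
      fix x assume x: "x \<in> carrier (product_module X)"
      show "\<exists>y\<in>carrier (product_module X). y \<oplus>\<^bsub>product_module X\<^esub> x = \<zero>\<^bsub>product_module X\<^esub>"
        using x by (intro bexI[of _ "\<lambda>n. \<ominus>\<^bsub>obj X n\<^esub> x n"])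
          (simp_all add: product_module_simps abelian_group.l_neg[OF G] abelian_group.a_inv_closed[OF G])
    next
      show "x \<oplus>\<^bsub>product_module X\<^esub> y = y \<oplus>\<^bsub>product_module X\<^esub> x"
        if "x \<in> carrier (product_module X)" "y \<in> carrier (product_module X)" for x y
        using that abelian_monoid.a_comm[OF abelian_group.axioms(1)[OF G]]
        by (simp add: product_module_simps)
    qed (simp_all add: product_module_simps abelian_monoid.a_assoc[OF abelian_group.axioms(1)[OF G]]
        abelian_monoid.a_closed[OF abelian_group.axioms(1)[OF G]]
        abelian_monoid.l_zero[OF abelian_group.axioms(1)[OF G]]
        abelian_monoid.zero_closed[OF abelian_group.axioms(1)[OF G]])
  qed (simp_all add: product_module_simps left_module.smult_closed[OF X] left_module.smult_l_distr[OF X]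
      left_module.smult_r_distr[OF X] left_module.smult_assoc[OF X] left_module.smult_one[OF X])
qed

lemma one_minus_shift_apply:
  "x \<in> carrier (product_module X) \<Longrightarrow>
    one_minus_shift X x = (\<lambda>n. x n \<ominus>\<^bsub>obj X n\<^esub> smap X (Suc n) (x (Suc n)))"
  by (simp add: one_minus_shift_def)

lemma one_minus_shift_linear:
  assumes X: "inverse_sequence R X"
  shows "one_minus_shift X \<in> linear_maps R (product_module X) (product_module X)"
proof -
  interpret P: left_module R "product_module X"
    by (rule product_left_module[OF X])
  have Xn: "left_module R (obj X n)" for n
    using X by (rule inverse_sequence_obj)
  have G: "abelian_group (obj X n)" for n
    using Xn by (simp add: left_module_def)
  have s_cl: "smap X (Suc n) (x (Suc n)) \<in> carrier (obj X n)" if "x \<in> carrier (product_module X)" for x n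
    using linear_maps_closed[OF inverse_sequence_smap[OF X]] that by (simp add: product_module_simps)
  have cl: "x n \<in> carrier (obj X n)" if "x \<in> carrier (product_module X)" for x n
    using that by (simp add: product_module_simps)
  show ?thesis
  proof (rule linear_mapsI)
    fix x assume x: "x \<in> carrier (product_module X)"
    show "one_minus_shift X x \<in> carrier (product_module X)"
      unfolding one_minus_shift_apply[OF x] product_module_simps
      by (intro allI abelian_group.minus_closed[OF G] cl s_cl x)
    fix y assume y: "y \<in> carrier (product_module X)"
    show "one_minus_shift X (x \<oplus>\<^bsub>product_module X\<^esub> y) =
      one_minus_shift X x \<oplus>\<^bsub>product_module X\<^esub> one_minus_shift X y"
      unfolding one_minus_shift_apply[OF x] one_minus_shift_apply[OF y]
        one_minus_shift_apply[OF P.M.a_closed[OF x y]] unfolding product_module_simps(3)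
      by (rule ext) (simp only: linear_maps_add[OF inverse_sequence_smap[OF X] cl[OF x] cl[OF y]]
          abelian_group.add_diff_add[OF G cl[OF x] cl[OF y] s_cl[OF x] s_cl[OF y]])
  next
    fix a x assume a: "a \<in> carrier R" and x: "x \<in> carrier (product_module X)"
    have smult_minus: "a \<odot>\<^bsub>obj X n\<^esub> (u \<ominus>\<^bsub>obj X n\<^esub> v) = a \<odot>\<^bsub>obj X n\<^esub> u \<ominus>\<^bsub>obj X n\<^esub> a \<odot>\<^bsub>obj X n\<^esub> v"
      if "u \<in> carrier (obj X n)" "v \<in> carrier (obj X n)" for n u v
      by (rule left_module.smult_diff[OF Xn a that])
    show "one_minus_shift X (a \<odot>\<^bsub>product_module X\<^esub> x) = a \<odot>\<^bsub>product_module X\<^esub> one_minus_shift X x"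
      unfolding one_minus_shift_apply[OF x] one_minus_shift_apply[OF P.smult_closed[OF a x]]
      unfolding product_module_simps(4)
      by (rule ext) (simp only: linear_maps_smult[OF inverse_sequence_smap[OF X] a cl[OF x]]
          smult_minus[OF cl[OF x] s_cl[OF x]])
  qed (simp add: one_minus_shift_def)
qed

text \<open>Surjectivity of all \<open>f\<^sub>n\<close> makes the induced map onto. The last assumption says that an element of the
  product of the \<open>A\<^sub>n\<close> lies in the image of \<open>1 - S\<close> as soon as its image in the product of the \<open>X\<^sub>n\<close> does.\<close>

lemma lim1_map_isoI:
  assumes A: "inverse_sequence R A" and X: "inverse_sequence R X" and f: "f \<in> inv_seq_hom R A X"
    and onto: "\<And>n y. y \<in> carrier (obj X n) \<Longrightarrow> \<exists>x\<in>carrier (obj A n). f n x = y"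
    and inj: "\<And>a y. (\<And>n. a n \<in> carrier (obj A n)) \<Longrightarrow> (\<And>n. y n \<in> carrier (obj X n)) \<Longrightarrow>
      (\<And>n. f n (a n) = y n \<ominus>\<^bsub>obj X n\<^esub> smap X (Suc n) (y (Suc n))) \<Longrightarrow>
      \<exists>u. \<forall>n. u n \<in> carrier (obj A n) \<and> a n = u n \<ominus>\<^bsub>obj A n\<^esub> smap A (Suc n) (u (Suc n))"
  shows "lim1_map A X f \<in> linear_isos R (lim1 A) (lim1 X)"
  unfolding lim1_map_def lim1_def coker_def
proof (rule quotient_map_iso)
  note Am = inverse_sequence_obj[OF A] and Xm = inverse_sequence_obj[OF X]
  note fl = inv_seq_hom_linear[OF f]
  let ?\<phi> = "\<lambda>x n. f n (x n)"
  show PA: "left_module R (product_module A)" and PX: "left_module R (product_module X)"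
    by (rule product_left_module[OF A], rule product_left_module[OF X])
  show "is_submodule R (product_module A) (one_minus_shift A ` carrier (product_module A))"
    by (rule is_submodule_image[OF one_minus_shift_linear[OF A] PA PA])
  show "is_submodule R (product_module X) (one_minus_shift X ` carrier (product_module X))"
    by (rule is_submodule_image[OF one_minus_shift_linear[OF X] PX PX])
  have cl: "?\<phi> x \<in> carrier (product_module X)" if "x \<in> carrier (product_module A)" for x
    using that linear_maps_closed[OF fl] by (simp add: product_module_simps)
  show "restrict ?\<phi> (carrier (product_module A)) \<in> linear_maps R (product_module A) (product_module X)"
  proof (rule linear_mapsI)
    fix x assume x: "x \<in> carrier (product_module A)"
    show "restrict ?\<phi> (carrier (product_module A)) x \<in> carrier (product_module X)"
      using cl[OF x] x by simp
    fix y assume y: "y \<in> carrier (product_module A)"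
    have "x \<oplus>\<^bsub>product_module A\<^esub> y \<in> carrier (product_module A)"
      using x y abelian_monoid.a_closed[OF abelian_group.axioms(1)] PA by (auto simp: left_module_def)
    then show "restrict ?\<phi> (carrier (product_module A)) (x \<oplus>\<^bsub>product_module A\<^esub> y) =
      restrict ?\<phi> (carrier (product_module A)) x \<oplus>\<^bsub>product_module X\<^esub>
      restrict ?\<phi> (carrier (product_module A)) y"
      using x y by (simp add: product_module_simps linear_maps_add[OF fl])
  next
    fix a x assume a: "a \<in> carrier R" and x: "x \<in> carrier (product_module A)"
    show "restrict ?\<phi> (carrier (product_module A)) (a \<odot>\<^bsub>product_module A\<^esub> x) =
      a \<odot>\<^bsub>product_module X\<^esub> restrict ?\<phi> (carrier (product_module A)) x"
      using x left_module.smult_closed[OF PA a x] a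
      by (simp add: product_module_simps linear_maps_smult[OF fl])
  qed simp
  show "\<exists>x\<in>carrier (product_module A). ?\<phi> x = y" if y: "y \<in> carrier (product_module X)" for y
  proof -
    have "\<forall>n. \<exists>x. x \<in> carrier (obj A n) \<and> f n x = y n"
      using onto y by (simp add: product_module_simps Bex_def)
    then obtain x where "\<forall>n. x n \<in> carrier (obj A n) \<and> f n (x n) = y n"
      by (rule choice[THEN exE])
    then show ?thesis
      by (intro bexI[of _ x]) (simp_all add: product_module_simps)
  qed
  show "?\<phi> x \<in> one_minus_shift X ` carrier (product_module X) \<longleftrightarrow>
    x \<in> one_minus_shift A ` carrier (product_module A)" if x: "x \<in> carrier (product_module A)" for x
  proof
    assume "?\<phi> x \<in> one_minus_shift X ` carrier (product_module X)"
    then obtain y where y: "y \<in> carrier (product_module X)" and eq: "?\<phi> x = one_minus_shift X y"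
      by (rule imageE)
    have "f n (x n) = y n \<ominus>\<^bsub>obj X n\<^esub> smap X (Suc n) (y (Suc n))" for n
      using fun_cong[OF eq, of n] by (simp only: one_minus_shift_apply[OF y])
    then obtain u where u: "\<forall>n. u n \<in> carrier (obj A n) \<and> x n = u n \<ominus>\<^bsub>obj A n\<^esub> smap A (Suc n) (u (Suc n))"
      using inj[of x y] x y by (auto simp: product_module_simps)
    then have uP: "u \<in> carrier (product_module A)"
      by (simp add: product_module_simps)
    have "one_minus_shift A u = x"
      unfolding one_minus_shift_apply[OF uP] using u by (intro ext) simp
    then show "x \<in> one_minus_shift A ` carrier (product_module A)"
      using uP by (rule image_eqI[OF sym])
  next
    assume "x \<in> one_minus_shift A ` carrier (product_module A)"
    then obtain u where u: "u \<in> carrier (product_module A)" and eq: "x = one_minus_shift A u"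
      by (rule imageE)
    have un: "u n \<in> carrier (obj A n)" for n
      using u by (simp add: product_module_simps)
    have sn: "smap A (Suc n) (u (Suc n)) \<in> carrier (obj A n)" for n
      by (rule linear_maps_closed[OF inverse_sequence_smap[OF A] un])
    have "?\<phi> x = one_minus_shift X (?\<phi> u)"
      unfolding eq one_minus_shift_apply[OF u] one_minus_shift_apply[OF cl[OF u]]
      by (rule ext) (simp only: linear_maps_diff[OF fl Am Xm un sn] inv_seq_hom_smap[OF f un])
    then show "?\<phi> x \<in> one_minus_shift X ` carrier (product_module X)"
      using cl[OF u] by (rule image_eqI)
  qed
qed

section \<open>Families with lifted defects\<close>

lemma linear_maps_minus:
  assumes f: "f \<in> linear_maps R M N" and g: "g \<in> linear_maps R M N"
    and M: "left_module R M" and N: "left_module R N"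
  shows "(\<lambda>x\<in>carrier M. f x \<ominus>\<^bsub>N\<^esub> g x) \<in> linear_maps R M N"
proof -
  interpret M: left_module R M by fact
  interpret N: left_module R N by fact
  note fcl = linear_maps_closed[OF f] and gcl = linear_maps_closed[OF g]
  show ?thesis
    by (rule linear_mapsI)
       (simp_all add: fcl gcl M.smult_closed linear_maps_add[OF f] linear_maps_add[OF g]
         linear_maps_smult[OF f] linear_maps_smult[OF g] N.M.add_diff_add N.smult_diff)
qed

context ring
begin

text \<open>The form in which uniqueness is used for naturality: commutativity of a square whose upper left corner
  is a free module.\<close>

lemma comp_agree:
  assumes g: "g \<in> linear_maps R (free_on R S) M" and f: "f \<in> linear_maps R M N"
    and g': "g' \<in> linear_maps R (free_on R S) M'" and f': "f' \<in> linear_maps R M' N"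
    and N: "left_module R N" and eq: "\<And>s. s \<in> S \<Longrightarrow> f (g (gen R s)) = f' (g' (gen R s))"
    and x: "x \<in> carrier (free_on R S)"
  shows "f (g x) = f' (g' x)"
proof -
  have "compose (carrier (free_on R S)) f g x = compose (carrier (free_on R S)) f' g' x"
    by (rule linear_maps_agree[OF linear_maps_comp[OF f g free_on_left_module]
          linear_maps_comp[OF f' g' free_on_left_module] N _ x])
       (simp only: compose_eq[OF gen_closed] eq)
  then show ?thesis
    by (simp only: compose_eq[OF x])
qed

definition free_map :: "'s set \<Rightarrow> 't set \<Rightarrow> ('s \<Rightarrow> 't) \<Rightarrow> ('s \<Rightarrow> 'a) \<Rightarrow> ('t \<Rightarrow> 'a)" where
  "free_map S T h = lin_ext R S (free_on R T) (\<lambda>s. gen R (h s))"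

lemma free_map_linear:
  "h \<in> S \<rightarrow> T \<Longrightarrow> free_map S T h \<in> linear_maps R (free_on R S) (free_on R T)"
  unfolding free_map_def by (rule lin_ext_linear[OF free_on_left_module]) (auto intro: gen_closed)

lemma free_map_gen:
  "h \<in> S \<rightarrow> T \<Longrightarrow> s \<in> S \<Longrightarrow> free_map S T h (gen R s) = gen R (h s)"
  unfolding free_map_def by (rule lin_ext_gen[OF free_on_left_module]) (auto intro: gen_closed)

lemma identity_linear: "(\<lambda>x\<in>carrier (free_on R S). x) \<in> linear_maps R (free_on R S) (free_on R S)"
  by (rule linear_mapsI) (simp_all add: free_on_add_closed free_on_smult_closed)

lemma free_map_id:
  assumes h: "\<And>s. s \<in> S \<Longrightarrow> h s = s" and x: "x \<in> carrier (free_on R S)"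
  shows "free_map S S h x = x"
proof -
  have hS: "h \<in> S \<rightarrow> S"
    using h by simp
  have "free_map S S h x = (\<lambda>x\<in>carrier (free_on R S). x) x"
    by (rule linear_maps_agree[OF free_map_linear[OF hS] identity_linear free_on_left_module _ x])
       (simp add: free_map_gen[OF hS] h gen_closed)
  with x show ?thesis
    by simp
qed

lemma free_map_comp:
  assumes h: "h \<in> S \<rightarrow> T" and h': "h' \<in> T \<rightarrow> U" and eq: "\<And>s. s \<in> S \<Longrightarrow> h'' s = h' (h s)"
    and x: "x \<in> carrier (free_on R S)"
  shows "free_map S U h'' x = free_map T U h' (free_map S T h x)"
proof -
  have h'': "h'' \<in> S \<rightarrow> U"
    using h h' eq by auto
  have "free_map T U h' (free_map S T h x) = (\<lambda>x\<in>carrier (free_on R U). x) (free_map S U h'' x)"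
  proof (rule comp_agree[OF free_map_linear[OF h] free_map_linear[OF h'] free_map_linear[OF h'']
        identity_linear free_on_left_module _ x])
    fix s assume s: "s \<in> S"
    then have "h s \<in> T" "h'' s \<in> U"
      using h h'' by auto
    then show "free_map T U h' (free_map S T h (gen R s)) =
        (\<lambda>x\<in>carrier (free_on R U). x) (free_map S U h'' (gen R s))"
      by (simp add: free_map_gen[OF h s] free_map_gen[OF h''  s] free_map_gen[OF h'] eq[OF s, symmetric] gen_closed)
  qed
  then show ?thesis
    by (simp add: linear_maps_closed[OF free_map_linear[OF h''] x])
qed

definition realize :: "('a, 'x) inv_seq \<Rightarrow> nat \<Rightarrow> ('x \<Rightarrow> 'a) \<Rightarrow> 'x" where
  "realize X k = lin_ext R (carrier (obj X k)) (obj X k) (\<lambda>x. x)"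

text \<open>The pullback of \<open>1 - S\<close> along the product of the maps \<open>realize X k\<close>.\<close>

definition witnesses :: "('a, 'x) inv_seq \<Rightarrow> ((nat \<Rightarrow> 'x) \<times> (nat \<Rightarrow> 'x \<Rightarrow> 'a)) set" where
  "witnesses X = {(y, b). \<forall>k. y k \<in> carrier (obj X k) \<and> b k \<in> carrier (free_on R (carrier (obj X k))) \<and>
     y k \<ominus>\<^bsub>obj X k\<^esub> smap X (Suc k) (y (Suc k)) = realize X k (b k)}"

definition entry :: "('a, 'x) inv_seq \<Rightarrow> nat \<Rightarrow> ((nat \<Rightarrow> 'x) \<times> (nat \<Rightarrow> 'x \<Rightarrow> 'a) \<Rightarrow> 'a) \<Rightarrow> 'x" where
  "entry X k = lin_ext R (witnesses X) (obj X k) (\<lambda>p. fst p k)"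

definition defect :: "('a, 'x) inv_seq \<Rightarrow> nat \<Rightarrow> ((nat \<Rightarrow> 'x) \<times> (nat \<Rightarrow> 'x \<Rightarrow> 'a) \<Rightarrow> 'a) \<Rightarrow> 'x \<Rightarrow> 'a" where
  "defect X k = lin_ext R (witnesses X) (free_on R (carrier (obj X k))) (\<lambda>p. snd p k)"

definition stage :: "('a, 'x) inv_seq \<Rightarrow> nat \<Rightarrow> ('a, (nat \<Rightarrow> 'x) \<times> (nat \<Rightarrow> 'x \<Rightarrow> 'a) \<Rightarrow> 'a) module" where
  "stage X n = (free_on R (witnesses X))
     \<lparr>carrier := {a \<in> carrier (free_on R (witnesses X)). \<forall>k<n. defect X k a = (\<lambda>_. \<zero>)}\<rparr>"

definition witness_map :: "('a, 'x) inv_seq \<Rightarrow> ('a, 'x) inv_seq \<Rightarrow> (nat \<Rightarrow> 'x \<Rightarrow> 'x) \<Rightarrow>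
    (nat \<Rightarrow> 'x) \<times> (nat \<Rightarrow> 'x \<Rightarrow> 'a) \<Rightarrow> (nat \<Rightarrow> 'x) \<times> (nat \<Rightarrow> 'x \<Rightarrow> 'a)" where
  "witness_map X Y h p =
     (\<lambda>k. h k (fst p k), \<lambda>k. free_map (carrier (obj X k)) (carrier (obj Y k)) (h k) (snd p k))"

lemma stage_simps:
  "a \<in> carrier (stage X n) \<longleftrightarrow> a \<in> carrier (free_on R (witnesses X)) \<and> (\<forall>k<n. defect X k a = (\<lambda>_. \<zero>))"
  "\<zero>\<^bsub>stage X n\<^esub> = (\<lambda>_. \<zero>)"
  "a \<oplus>\<^bsub>stage X n\<^esub> b = (\<lambda>s. a s \<oplus> b s)"
  "c \<odot>\<^bsub>stage X n\<^esub> a = (\<lambda>s. c \<otimes> a s)"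
  by (simp_all add: stage_def free_on_def)

lemma realize_linear:
  "inverse_sequence R X \<Longrightarrow> realize X k \<in> linear_maps R (free_on R (carrier (obj X k))) (obj X k)"
  unfolding realize_def by (intro lin_ext_linear inverse_sequence_obj) auto

lemma realize_gen:
  "inverse_sequence R X \<Longrightarrow> x \<in> carrier (obj X k) \<Longrightarrow> realize X k (gen R x) = x"
  unfolding realize_def by (intro lin_ext_gen inverse_sequence_obj) auto

lemma entry_linear:
  "inverse_sequence R X \<Longrightarrow> entry X k \<in> linear_maps R (free_on R (witnesses X)) (obj X k)"
  unfolding entry_def by (intro lin_ext_linear inverse_sequence_obj) (auto simp: witnesses_def)

lemma entry_gen: "inverse_sequence R X \<Longrightarrow> p \<in> witnesses X \<Longrightarrow> entry X k (gen R p) = fst p k"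
  unfolding entry_def by (intro lin_ext_gen inverse_sequence_obj) (auto simp: witnesses_def)

lemma defect_linear:
  "defect X k \<in> linear_maps R (free_on R (witnesses X)) (free_on R (carrier (obj X k)))"
  unfolding defect_def by (intro lin_ext_linear free_on_left_module) (auto simp: witnesses_def)

lemma defect_gen: "p \<in> witnesses X \<Longrightarrow> defect X k (gen R p) = snd p k"
  unfolding defect_def by (intro lin_ext_gen free_on_left_module) (auto simp: witnesses_def)

text \<open>The equation that defines \<open>witnesses X\<close> holds for the generators, and both sides are linear.\<close>

lemma entry_diff:
  assumes X: "inverse_sequence R X" and a: "a \<in> carrier (free_on R (witnesses X))"
  shows "entry X k a \<ominus>\<^bsub>obj X k\<^esub> smap X (Suc k) (entry X (Suc k) a) = realize X k (defect X k a)"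
proof -
  let ?F = "free_on R (witnesses X)"
  have s: "compose (carrier ?F) (smap X (Suc k)) (entry X (Suc k)) \<in> linear_maps R ?F (obj X k)"
    by (rule linear_maps_comp[OF inverse_sequence_smap[OF X] entry_linear[OF X] free_on_left_module])
  have r: "compose (carrier ?F) (realize X k) (defect X k) \<in> linear_maps R ?F (obj X k)"
    by (rule linear_maps_comp[OF realize_linear[OF X] defect_linear free_on_left_module])
  have "(\<lambda>a\<in>carrier ?F. entry X k a \<ominus>\<^bsub>obj X k\<^esub> compose (carrier ?F) (smap X (Suc k)) (entry X (Suc k)) a) a =
      compose (carrier ?F) (realize X k) (defect X k) a"
    by (rule linear_maps_agree[OF linear_maps_minus[OF entry_linear[OF X] s free_on_left_module
          inverse_sequence_obj[OF X]] r inverse_sequence_obj[OF X] _ a])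
       (auto simp: gen_closed compose_eq entry_gen[OF X] defect_gen, auto simp: witnesses_def)
  then show ?thesis
    by (simp add: a compose_eq)
qed

lemma stage_entry:
  assumes "inverse_sequence R X" "a \<in> carrier (stage X (Suc n))"
  shows "entry X n a = smap X (Suc n) (entry X (Suc n) a)"
proof -
  interpret Xn: left_module R "obj X n"
    using assms(1) by (rule inverse_sequence_obj)
  have a: "a \<in> carrier (free_on R (witnesses X))" "defect X n a = (\<lambda>_. \<zero>)"
    using assms(2) by (simp_all add: stage_simps)
  have "realize X n (\<lambda>_. \<zero>) = \<zero>\<^bsub>obj X n\<^esub>"
    using linear_maps_zero[OF realize_linear[OF assms(1)] free_on_left_module Xn.left_module_axioms] by simp
  then have "entry X n a \<ominus>\<^bsub>obj X n\<^esub> smap X (Suc n) (entry X (Suc n) a) = \<zero>\<^bsub>obj X n\<^esub>"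
    using entry_diff[OF assms(1) a(1), of n] by (simp only: a(2))
  then show ?thesis
    using Xn.M.right_minus_eq linear_maps_closed[OF entry_linear[OF assms(1)] a(1)]
      linear_maps_closed[OF inverse_sequence_smap[OF assms(1)]] by simp
qed

text \<open>An element of \<open>X\<^sub>n\<close> can be pushed down to all lower levels and continued by zero above, so that only
  the equation at level \<open>n\<close> fails.\<close>

lemma ex_thread:
  assumes X: "inverse_sequence R X" and "x \<in> carrier (obj X n)"
  shows "\<exists>y. y n = x \<and> (\<forall>k. y k \<in> carrier (obj X k)) \<and> (\<forall>k>n. y k = \<zero>\<^bsub>obj X k\<^esub>) \<and>
    (\<forall>k<n. y k = smap X (Suc k) (y (Suc k)))"
  using assms(2)
proof (induction n arbitrary: x)
  case 0
  have "\<zero>\<^bsub>obj X k\<^esub> \<in> carrier (obj X k)" for k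
    using inverse_sequence_obj[OF X] by (intro abelian_monoid.zero_closed abelian_group.axioms(1)) (simp add: left_module_def)
  with 0 show ?case
    by (intro exI[of _ "\<lambda>k. if k = 0 then x else \<zero>\<^bsub>obj X k\<^esub>"]) simp
next
  case (Suc n)
  have "smap X (Suc n) x \<in> carrier (obj X n)"
    by (rule linear_maps_closed[OF inverse_sequence_smap[OF X] Suc.prems])
  from Suc.IH[OF this] obtain y where y: "y n = smap X (Suc n) x" "\<forall>k. y k \<in> carrier (obj X k)"
    "\<forall>k>n. y k = \<zero>\<^bsub>obj X k\<^esub>" "\<forall>k<n. y k = smap X (Suc k) (y (Suc k))"
    by auto
  then show ?case
    using Suc.prems by (intro exI[of _ "y(Suc n := x)"]) (auto simp: less_Suc_eq)
qed

lemma ex_basic_witness: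
  assumes X: "inverse_sequence R X" and x: "x \<in> carrier (obj X n)"
  shows "\<exists>p\<in>witnesses X. fst p n = x \<and> snd p = (\<lambda>k. if k = n then gen R x else (\<lambda>_. \<zero>))"
proof -
  obtain y where y: "y n = x" "\<And>k. y k \<in> carrier (obj X k)" "\<And>k. k > n \<Longrightarrow> y k = \<zero>\<^bsub>obj X k\<^esub>"
    "\<And>k. k < n \<Longrightarrow> y k = smap X (Suc k) (y (Suc k))"
    using ex_thread[OF X x] by blast
  define b where "b = (\<lambda>k. if k = n then gen R x else (\<lambda>_. \<zero>))"
  have "y k \<ominus>\<^bsub>obj X k\<^esub> smap X (Suc k) (y (Suc k)) = realize X k (b k)" for k
  proof -
    interpret Xk: left_module R "obj X k"
      using X by (rule inverse_sequence_obj)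
    note s = inverse_sequence_smap[OF X, of k]
    have s0: "smap X (Suc k) \<zero>\<^bsub>obj X (Suc k)\<^esub> = \<zero>\<^bsub>obj X k\<^esub>"
      by (rule linear_maps_zero[OF s inverse_sequence_obj[OF X] inverse_sequence_obj[OF X]])
    have r0: "realize X k (\<lambda>_. \<zero>) = \<zero>\<^bsub>obj X k\<^esub>"
      using linear_maps_zero[OF realize_linear[OF X] free_on_left_module Xk.left_module_axioms] by simp
    consider "k < n" | "k = n" | "k > n"
      by linarith
    then show ?thesis
    proof cases
      case 1
      then show ?thesis
        using y(2)[of k] y(4)[OF 1] by (simp add: b_def r0 Xk.M.right_minus_eq linear_maps_closed[OF s y(2)])
    next
      case 2
      have "x \<ominus>\<^bsub>obj X k\<^esub> \<zero>\<^bsub>obj X k\<^esub> = x"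
        using x 2 Xk.M.minus_equality[OF Xk.M.l_zero[OF Xk.M.zero_closed]] Xk.M.zero_closed Xk.M.r_zero by (simp add: a_minus_def)
      then show ?thesis
        using x y(1) y(3)[of "Suc k"] s0 2 by (simp add: b_def realize_gen[OF X])
    next
      case 3
      then show ?thesis
        using y(3)[of k] y(3)[of "Suc k"] s0 by (simp add: b_def r0 a_minus_def)
    qed
  qed
  moreover have "b k \<in> carrier (free_on R (carrier (obj X k)))" for k
    using x by (auto simp: b_def gen_closed) (simp add: free_on_carrier)
  ultimately have "(y, b) \<in> witnesses X"
    using y(2) by (simp add: witnesses_def)
  with y(1) show ?thesis
    by (intro bexI[of _ "(y, b)"]) (simp_all add: b_def)
qed

end

section \<open>The filtration of the free module on these families\<close>

context ring
begin

lemma free_on_value: "g \<in> carrier (free_on R S) \<Longrightarrow> g s \<in> carrier R"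
  unfolding free_on_carrier by (elim conjE) (erule spec)

lemma stage_subset: "a \<in> carrier (stage X n) \<Longrightarrow> a \<in> carrier (free_on R (witnesses X))"
  by (simp add: stage_simps)

text \<open>Truncation of the defects to the levels below \<open>n\<close> is a map to the free module on the disjoint union of
  these \<open>X\<^sub>k\<close>, with kernel \<open>stage X n\<close>. Each of its generators comes from a generator, namely from a basic
  witness, so the kernel is free.\<close>

lemma stage_free:
  assumes X: "inverse_sequence R X"
  shows "\<exists>(S' :: ((nat \<Rightarrow> 'x) \<times> (nat \<Rightarrow> 'x \<Rightarrow> 'a)) set) \<Phi>. \<Phi> \<in> linear_isos R (free_on R S') (stage (X :: ('a, 'x) inv_seq) n)"
proof -
  let ?F = "free_on R (witnesses X)"
  define T where "T = (SIGMA k:{..<n}. carrier (obj X k))"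
  define g where "g = (\<lambda>a\<in>carrier ?F. \<lambda>(k, x). if k < n then defect X k a x else \<zero>)"
  have g_apply: "g a = (\<lambda>(k, x). if k < n then defect X k a x else \<zero>)" if "a \<in> carrier ?F" for a
    using that by (simp add: g_def)
  have defect_cl: "defect X k a \<in> carrier (free_on R (carrier (obj X k)))" if "a \<in> carrier ?F" for a k
    by (rule linear_maps_closed[OF defect_linear that])
  have g: "g \<in> linear_maps R ?F (free_on R T)"
  proof (rule linear_mapsI)
    fix a assume a: "a \<in> carrier ?F"
    have "{t. g a t \<noteq> \<zero>} \<subseteq> (SIGMA k:{..<n}. {x. defect X k a x \<noteq> \<zero>})"
      by (auto simp: g_apply[OF a] split: if_splits)
    moreover have "finite (SIGMA k:{..<n}. {x. defect X k a x \<noteq> \<zero>})"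
      by (rule finite_SigmaI) (use defect_cl[OF a] in \<open>auto simp: free_on_carrier\<close>)
    ultimately have "finite {t. g a t \<noteq> \<zero>}"
      by (rule finite_subset)
    moreover have "{t. g a t \<noteq> \<zero>} \<subseteq> T"
      using defect_cl[OF a] by (fastforce simp: g_apply[OF a] free_on_carrier T_def split: if_splits)
    moreover have "g a t \<in> carrier R" for t
      using defect_cl[OF a] by (simp add: g_apply[OF a] free_on_carrier split: prod.split)
    ultimately show "g a \<in> carrier (free_on R T)"
      by (simp add: free_on_carrier)
    fix b assume b: "b \<in> carrier ?F"
    have "defect X k (\<lambda>s. a s \<oplus> b s) = (\<lambda>x. defect X k a x \<oplus> defect X k b x)" for k
      using linear_maps_add[OF defect_linear a b] by simp
    then show "g (a \<oplus>\<^bsub>?F\<^esub> b) = g a \<oplus>\<^bsub>free_on R T\<^esub> g b"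
      by (auto simp: g_apply[OF a] g_apply[OF b] g_apply[OF free_on_add_closed[OF a b]])
  next
    fix c a assume c: "c \<in> carrier R" and a: "a \<in> carrier ?F"
    have "defect X k (\<lambda>s. c \<otimes> a s) = (\<lambda>x. c \<otimes> defect X k a x)" for k
      using linear_maps_smult[OF defect_linear c a] by simp
    then show "g (c \<odot>\<^bsub>?F\<^esub> a) = c \<odot>\<^bsub>free_on R T\<^esub> g a"
      using c by (auto simp: g_apply[OF a] g_apply[OF free_on_smult_closed[OF a c]])
  qed (simp add: g_def)
  define \<sigma> where "\<sigma> = (\<lambda>(k, x). SOME p. p \<in> witnesses X \<and> snd p = (\<lambda>j. if j = k then gen R x else (\<lambda>_. \<zero>)))"
  have \<sigma>: "\<sigma> (k, x) \<in> witnesses X \<and> snd (\<sigma> (k, x)) = (\<lambda>j. if j = k then gen R x else (\<lambda>_. \<zero>))"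
    if x: "x \<in> carrier (obj X k)" for k x
    unfolding \<sigma>_def prod.case by (rule someI_ex) (use ex_basic_witness[OF X x] in \<open>auto simp: Bex_def\<close>)
  have sec: "g (gen R (\<sigma> t)) = gen R t" if t: "t \<in> T" for t
  proof -
    obtain k x where kx: "t = (k, x)" "k < n" "x \<in> carrier (obj X k)"
      using t by (auto simp: T_def)
    note p = \<sigma>[OF kx(3)]
    show ?thesis
      unfolding kx(1) g_apply[OF gen_closed[OF p[THEN conjunct1]]] defect_gen[OF p[THEN conjunct1]]
        p[THEN conjunct2]
      using kx(2) by (auto simp: gen_def)
  qed
  have "\<sigma> \<in> T \<rightarrow> witnesses X"
    using \<sigma> by (auto simp: T_def)
  from free_kernel[OF ring_axioms g this sec]
  have "\<exists>(S' :: ((nat \<Rightarrow> 'x) \<times> (nat \<Rightarrow> 'x \<Rightarrow> 'a)) set) \<Phi>. \<Phi> \<in> linear_isos R (free_on R S')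
      (?F\<lparr>carrier := {a \<in> carrier ?F. g a = (\<lambda>_. \<zero>)}\<rparr>)"
    by simp
  moreover have "g a = (\<lambda>_. \<zero>) \<longleftrightarrow> (\<forall>k<n. defect X k a = (\<lambda>_. \<zero>))" if a: "a \<in> carrier ?F" for a
    unfolding g_apply[OF a] by (auto simp: fun_eq_iff)
  then have "{a \<in> carrier ?F. g a = (\<lambda>_. \<zero>)} = {a \<in> carrier ?F. \<forall>k<n. defect X k a = (\<lambda>_. \<zero>)}"
    by (simp cong: conj_cong)
  ultimately show ?thesis
    by (simp only: stage_def)
qed

lemma stage_iso_zero:
  assumes "\<Phi> \<in> linear_isos R (free_on R S) (stage X n)"
  shows "\<Phi> (\<lambda>_. \<zero>) = (\<lambda>_. \<zero>)"
proof -
  interpret F: left_module R "free_on R S"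
    by (rule free_on_left_module)
  have lin: "\<Phi> \<in> linear_maps R (free_on R S) (stage X n)"
    using assms by (simp add: linear_isos_def)
  have z: "(\<lambda>_. \<zero>) \<in> carrier (free_on R S)"
    using F.M.zero_closed by simp
  have val: "\<Phi> (\<lambda>_. \<zero>) s \<in> carrier R" for s
    by (rule free_on_value[OF stage_subset[OF linear_maps_closed[OF lin z]]])
  have "\<Phi> (\<lambda>_. \<zero>) = (\<lambda>s. \<zero> \<otimes> \<Phi> (\<lambda>_. \<zero>) s)"
    using linear_maps_smult[OF lin zero_closed z] by (simp add: stage_simps)
  also have "\<dots> = (\<lambda>_. \<zero>)"
    by (rule ext) (rule l_null[OF val])
  finally show ?thesis .
qed

lemma stage_left_module:
  fixes X :: "('a, 'x) inv_seq"
  assumes X: "inverse_sequence R X"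
  shows "left_module R (stage X n)"
proof -
  obtain S' :: "((nat \<Rightarrow> 'x) \<times> (nat \<Rightarrow> 'x \<Rightarrow> 'a)) set" and \<Phi>
    where \<Phi>: "\<Phi> \<in> linear_isos R (free_on R S') (stage X n)"
    using stage_free[OF X] by blast
  then have lin: "\<Phi> \<in> linear_maps R (free_on R S') (stage X n)"
    and bij: "bij_betw \<Phi> (carrier (free_on R S')) (carrier (stage X n))"
    by (simp_all add: linear_isos_def)
  show ?thesis
    using free_on_left_module bij
    by (rule left_module_transfer)
       (simp_all only: linear_maps_add[OF lin] linear_maps_smult[OF lin], simp add: stage_iso_zero[OF \<Phi>] stage_simps)
qed

lemma stage_defect_onto:
  assumes X: "inverse_sequence R X" and w: "w \<in> carrier (free_on R (carrier (obj X n)))"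
  shows "\<exists>a\<in>carrier (stage X n). defect X n a = w"
  using w
proof (induction w rule: free_on_induct)
  case zero
  have "(\<lambda>_. \<zero>) \<in> carrier (free_on R (witnesses X))"
    by (simp add: free_on_carrier)
  moreover have "defect X k (\<lambda>_. \<zero>) = (\<lambda>_. \<zero>)" for k
    using linear_maps_zero[OF defect_linear free_on_left_module free_on_left_module, of X k] by simp
  ultimately show ?case
    by (intro bexI[of _ "\<lambda>_. \<zero>"]) (simp_all add: stage_simps)
next
  case (add w c x)
  interpret K: left_module R "stage X n"
    by (rule stage_left_module[OF X])
  obtain a where a: "a \<in> carrier (stage X n)" "defect X n a = w"
    using add by blast
  obtain p where p: "p \<in> witnesses X" "snd p = (\<lambda>k. if k = n then gen R x else (\<lambda>_. \<zero>))"
    using ex_basic_witness[OF X add.hyps(3)] by blast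
  have gp: "gen R p \<in> carrier (stage X n)"
    using p by (simp add: stage_simps gen_closed defect_gen)
  have cl: "a \<oplus>\<^bsub>stage X n\<^esub> c \<odot>\<^bsub>stage X n\<^esub> gen R p \<in> carrier (stage X n)"
    by (intro K.M.a_closed K.smult_closed a gp add)
  have "defect X n (a \<oplus>\<^bsub>stage X n\<^esub> c \<odot>\<^bsub>stage X n\<^esub> gen R p) =
      defect X n (a \<oplus>\<^bsub>free_on R (witnesses X)\<^esub> c \<odot>\<^bsub>free_on R (witnesses X)\<^esub> gen R p)"
    by (simp add: stage_simps)
  also have "\<dots> = w \<oplus>\<^bsub>free_on R (carrier (obj X n))\<^esub> c \<odot>\<^bsub>free_on R (carrier (obj X n))\<^esub> gen R x"
    using linear_maps_add[OF defect_linear stage_subset[OF a(1)], of "c \<odot>\<^bsub>free_on R (witnesses X)\<^esub> gen R p" n]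
      linear_maps_smult[OF defect_linear add.hyps(2) gen_closed[OF p(1)], of n] add.hyps
      free_on_smult_closed[OF gen_closed[OF p(1)], of c] a(2)
    by (simp add: defect_gen[OF p(1)] p(2))
  finally show ?case
    using cl by blast
qed

text \<open>This is injectivity on the first derived limit, before the encoding; \<open>u\<^sub>n - u\<^sub>n\<^sub>+\<^sub>1 = \<alpha>\<^sub>n\<close> is written
  additively. The sum of all \<open>\<alpha>\<^sub>n\<close> does not exist in the free module, but its defects do, since only finitely
  many \<open>\<alpha>\<^sub>n\<close> have a nonzero defect at a given level. The equations for \<open>y\<close> say that these defects are those of a
  family, so they come from a single generator, which takes the place of the infinite sum.\<close>

lemma stage_shift_onto:
  assumes X: "inverse_sequence R X"
    and \<alpha>: "\<And>n. \<alpha> n \<in> carrier (stage X n)" and y: "\<And>n. y n \<in> carrier (obj X n)"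
    and eq: "\<And>n. entry X n (\<alpha> n) = y n \<ominus>\<^bsub>obj X n\<^esub> smap X (Suc n) (y (Suc n))"
  shows "\<exists>u. \<forall>n. u n \<in> carrier (stage X n) \<and> u n = (\<lambda>s. \<alpha> n s \<oplus> u (Suc n) s)"
proof -
  let ?F = "free_on R (witnesses X)"
  interpret F: left_module R ?F
    by (rule free_on_left_module)
  define S where "S = rec_nat (\<lambda>_. \<zero>) (\<lambda>n a. a \<oplus>\<^bsub>?F\<^esub> \<alpha> n)"
  have S_0: "S 0 = \<zero>\<^bsub>?F\<^esub>" and S_Suc: "S (Suc n) = S n \<oplus>\<^bsub>?F\<^esub> \<alpha> n" for n
    by (simp_all add: S_def)
  have \<alpha>F: "\<alpha> n \<in> carrier ?F" for n
    by (rule stage_subset[OF \<alpha>])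
  have SF: "S n \<in> carrier ?F" for n
    by (induction n) (simp_all only: S_0 S_Suc F.M.zero_closed F.M.a_closed \<alpha>F)
  have defect_S: "defect X k (S n) = defect X k (S (Suc k))" if "Suc k \<le> n" for k n
    using that
  proof (induction n rule: dec_induct)
    case (step n)
    have "defect X k (\<alpha> n) = (\<lambda>_. \<zero>)"
      using \<alpha>[of n] step.hyps by (simp add: stage_simps)
    moreover have "defect X k (S n) s \<in> carrier R" for s
      using linear_maps_closed[OF defect_linear SF[of n], of k] by (simp add: free_on_carrier)
    ultimately have "defect X k (S (Suc n)) = defect X k (S n)"
      unfolding S_Suc linear_maps_add[OF defect_linear SF \<alpha>F] by simp
    with step.IH show ?case
      by simp
  qed simp
  \<comment> \<open>The defect of \<open>S n\<close> at \<open>k\<close> is constant from \<open>n = Suc k\<close> on, hence \<open>b k\<close> is the defect of the infinite sum.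
    The entries at \<open>k\<close> of \<open>\<alpha> n\<close> for \<open>n \<ge> k\<close> are the images of \<open>y n - s (y (n + 1))\<close> in level \<open>k\<close>; their formal sum
    telescopes to \<open>y k\<close>.\<close>
  define Y where "Y = (\<lambda>k. y k \<oplus>\<^bsub>obj X k\<^esub> entry X k (S k))"
  define b where "b = (\<lambda>k. defect X k (S (Suc k)))"
  have entry_S: "entry X k (S n) \<in> carrier (obj X k)" for k n
    by (rule linear_maps_closed[OF entry_linear[OF X] SF])
  have p: "(Y, b) \<in> witnesses X"
  proof -
    have "Y k \<in> carrier (obj X k) \<and> b k \<in> carrier (free_on R (carrier (obj X k))) \<and>
        Y k \<ominus>\<^bsub>obj X k\<^esub> smap X (Suc k) (Y (Suc k)) = realize X k (b k)" for k
    proof -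
      interpret Xk: left_module R "obj X k"
        using X by (rule inverse_sequence_obj)
      interpret Xk1: left_module R "obj X (Suc k)"
        using X by (rule inverse_sequence_obj)
      note s = inverse_sequence_smap[OF X, of k]
      have sy: "smap X (Suc k) (y (Suc k)) \<in> carrier (obj X k)"
        by (rule linear_maps_closed[OF s y])
      have se: "smap X (Suc k) (entry X (Suc k) (S (Suc k))) \<in> carrier (obj X k)"
        by (rule linear_maps_closed[OF s entry_S])
      have "Y k \<in> carrier (obj X k)"
        unfolding Y_def by (intro Xk.M.a_closed y entry_S)
      moreover have "b k \<in> carrier (free_on R (carrier (obj X k)))"
        unfolding b_def by (rule linear_maps_closed[OF defect_linear SF])
      moreover have "Y k \<ominus>\<^bsub>obj X k\<^esub> smap X (Suc k) (Y (Suc k)) =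
          (y k \<ominus>\<^bsub>obj X k\<^esub> smap X (Suc k) (y (Suc k))) \<oplus>\<^bsub>obj X k\<^esub>
          (entry X k (S k) \<ominus>\<^bsub>obj X k\<^esub> smap X (Suc k) (entry X (Suc k) (S (Suc k))))"
        unfolding Y_def linear_maps_add[OF s y entry_S] by (rule Xk.M.add_diff_add[OF y entry_S sy se])
      moreover have "\<dots> = (entry X k (S k) \<oplus>\<^bsub>obj X k\<^esub> entry X k (\<alpha> k)) \<ominus>\<^bsub>obj X k\<^esub>
          smap X (Suc k) (entry X (Suc k) (S (Suc k)))"
        unfolding eq[symmetric]
        using linear_maps_closed[OF entry_linear[OF X] \<alpha>F, of k k] entry_S[of k k] se
        by (simp add: a_minus_def Xk.M.a_ac)
      moreover have "\<dots> = realize X k (b k)"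
        unfolding linear_maps_add[OF entry_linear[OF X] SF \<alpha>F, symmetric] S_Suc[symmetric] b_def
        by (rule entry_diff[OF X SF])
      ultimately show ?thesis
        by simp
    qed
    then show ?thesis
      by (simp add: witnesses_def)
  qed
  note gp = gen_closed[OF p]
  define u where "u = (\<lambda>n. gen R (Y, b) \<ominus>\<^bsub>?F\<^esub> S n)"
  have uF: "u n \<in> carrier ?F" for n
    unfolding u_def by (rule F.M.minus_closed[OF gp SF])
  have "defect X k (u n) = (\<lambda>_. \<zero>)" if "k < n" for k n
  proof -
    have "defect X k (gen R (Y, b)) = b k"
      using defect_gen[OF p, of k] by simp
    with defect_S[of k n] that have eq: "defect X k (S n) = defect X k (gen R (Y, b))"
      by (simp add: b_def)
    interpret B: left_module R "free_on R (carrier (obj X k))"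
      by (rule free_on_left_module)
    have "defect X k (u n) = \<zero>\<^bsub>free_on R (carrier (obj X k))\<^esub>"
      unfolding u_def linear_maps_diff[OF defect_linear F.left_module_axioms B.left_module_axioms gp SF] eq
      unfolding B.M.minus_eq by (rule B.M.r_neg[OF linear_maps_closed[OF defect_linear gp]])
    then show ?thesis
      by (simp only: free_on_simps)
  qed
  then have "u n \<in> carrier (stage X n)" for n
    using uF by (simp add: stage_simps)
  moreover have "u n = (\<lambda>s. \<alpha> n s \<oplus> u (Suc n) s)" for n
  proof
    fix s
    have cl: "gen R (Y, b) s \<in> carrier R" "S n s \<in> carrier R" "\<alpha> n s \<in> carrier R"
      by (rule free_on_value[OF gp], rule free_on_value[OF SF], rule free_on_value[OF \<alpha>F])
    have "u n s = gen R (Y, b) s \<ominus> S n s"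
      unfolding u_def free_on_minus[OF gp SF] ..
    moreover have "u (Suc n) s = gen R (Y, b) s \<ominus> (S n s \<oplus> \<alpha> n s)"
      unfolding u_def free_on_minus[OF gp SF] S_Suc by simp
    moreover have "\<alpha> n s \<oplus> (gen R (Y, b) s \<ominus> (S n s \<oplus> \<alpha> n s)) = gen R (Y, b) s \<ominus> S n s"
    proof -
      have "\<alpha> n s \<oplus> (gen R (Y, b) s \<ominus> (S n s \<oplus> \<alpha> n s)) =
          (gen R (Y, b) s \<ominus> S n s) \<oplus> (\<alpha> n s \<oplus> \<ominus> \<alpha> n s)"
        unfolding a_minus_def minus_add[OF cl(2,3)] using cl by (simp only: a_ac a_closed a_inv_closed)
      then show ?thesis
        using cl by (simp add: r_neg)
    qed
    ultimately show "u n s = \<alpha> n s \<oplus> u (Suc n) s"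
      by simp
  qed
  ultimately show ?thesis
    by blast
qed

end

section \<open>Transport of the filtration to the given universe\<close>

locale filtration_encoding = ring R for R :: "('r, 'k) ring_scheme" (structure) +
  fixes \<iota> :: "((nat \<Rightarrow> 'x) \<times> (nat \<Rightarrow> 'x \<Rightarrow> 'r) \<Rightarrow> 'r) \<Rightarrow> 'y"
  assumes inj_encode: "inj_on \<iota> (nested_finite_support \<zero>)"
begin

text \<open>One decoding for all stages and all \<open>X\<close>, so that the operations of a stage restrict to those of the next
  and the structure maps can be inclusions.\<close>

definition decode :: "'y \<Rightarrow> (nat \<Rightarrow> 'x) \<times> (nat \<Rightarrow> 'x \<Rightarrow> 'r) \<Rightarrow> 'r" where
  "decode = inv_into (nested_finite_support \<zero>) \<iota>"

definition filt :: "('r, 'x) inv_seq \<Rightarrow> ('r, 'y) inv_seq" where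
  "filt X = \<lparr>obj = (\<lambda>n. \<lparr>carrier = \<iota> ` carrier (stage X n), mult = undefined, one = undefined,
       zero = \<iota> (\<lambda>_. \<zero>), add = (\<lambda>u v. \<iota> (\<lambda>p. decode u p \<oplus> decode v p)),
       smult = (\<lambda>c u. \<iota> (\<lambda>p. c \<otimes> decode u p))\<rparr>),
     smap = (\<lambda>n. \<lambda>u\<in>\<iota> ` carrier (stage X n). u)\<rparr>"

definition filt_map :: "('r, 'x) inv_seq \<Rightarrow> ('r, 'x) inv_seq \<Rightarrow> (nat \<Rightarrow> 'x \<Rightarrow> 'x) \<Rightarrow> nat \<Rightarrow> 'y \<Rightarrow> 'y" where
  "filt_map X Y h = (\<lambda>n. \<lambda>u\<in>carrier (obj (filt X) n).
     \<iota> (free_map (witnesses X) (witnesses Y) (witness_map X Y h) (decode u)))"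

definition filt_hom :: "('r, 'x) inv_seq \<Rightarrow> nat \<Rightarrow> 'y \<Rightarrow> 'x" where
  "filt_hom X = (\<lambda>n. \<lambda>u\<in>carrier (obj (filt X) n). entry X n (decode u))"

lemma decode_encode:
  assumes "a \<in> carrier (free_on R (witnesses X))"
  shows "decode (\<iota> a) = a"
proof -
  have "{p. a p \<noteq> \<zero>} \<subseteq> witnesses X" "finite {p. a p \<noteq> \<zero>}"
    using assms unfolding free_on_carrier by (blast, blast)
  moreover have "witnesses X \<subseteq> {p. \<forall>k. finite {x. snd p k x \<noteq> \<zero>}}"
    by (auto simp: witnesses_def free_on_carrier)
  ultimately show ?thesis
    unfolding decode_def by (intro inv_into_f_f[OF inj_encode]) blast
qed

lemma decode_stage: "a \<in> carrier (stage X n) \<Longrightarrow> decode (\<iota> a) = a"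
  by (rule decode_encode[OF stage_subset])

lemma filt_carrier: "carrier (obj (filt X) n) = \<iota> ` carrier (stage X n)"
  by (simp add: filt_def)

lemma filt_encode: "a \<in> carrier (stage X n) \<Longrightarrow> \<iota> a \<in> carrier (obj (filt X) n)"
  by (simp add: filt_carrier)

lemma filt_cases:
  assumes "u \<in> carrier (obj (filt X) n)"
  obtains a where "a \<in> carrier (stage X n)" "u = \<iota> a"
  using assms unfolding filt_carrier by (rule imageE)

lemma filt_add:
  "a \<in> carrier (stage X n) \<Longrightarrow> b \<in> carrier (stage X n) \<Longrightarrow>
    \<iota> a \<oplus>\<^bsub>obj (filt X) n\<^esub> \<iota> b = \<iota> (\<lambda>p. a p \<oplus> b p)"
  by (simp add: filt_def decode_stage)

lemma filt_smult:
  "a \<in> carrier (stage X n) \<Longrightarrow> c \<odot>\<^bsub>obj (filt X) n\<^esub> \<iota> a = \<iota> (\<lambda>p. c \<otimes> a p)"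
  by (simp add: filt_def decode_stage)

lemma filt_zero: "\<zero>\<^bsub>obj (filt X) n\<^esub> = \<iota> (\<lambda>_. \<zero>)"
  by (simp add: filt_def)

lemma filt_smap: "u \<in> carrier (obj (filt X) n) \<Longrightarrow> smap (filt X) n u = u"
  by (simp add: filt_def)

lemma stage_add_closed:
  "inverse_sequence R X \<Longrightarrow> a \<in> carrier (stage X n) \<Longrightarrow> b \<in> carrier (stage X n) \<Longrightarrow>
    (\<lambda>p. a p \<oplus> b p) \<in> carrier (stage X n)"
  using abelian_monoid.a_closed[OF abelian_group.axioms(1), of "stage X n" a b]
    stage_left_module[of X n] by (simp add: left_module_def stage_simps(3))

lemma stage_smult_closed:
  "inverse_sequence R X \<Longrightarrow> c \<in> carrier R \<Longrightarrow> a \<in> carrier (stage X n) \<Longrightarrow>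
    (\<lambda>p. c \<otimes> a p) \<in> carrier (stage X n)"
  using left_module.smult_closed[OF stage_left_module, of X c a n] by (simp add: stage_simps(4))

lemma stage_zero_closed: "inverse_sequence R X \<Longrightarrow> (\<lambda>_. \<zero>) \<in> carrier (stage X n)"
  using abelian_monoid.zero_closed[OF abelian_group.axioms(1), of "stage X n"]
    stage_left_module[of X n] by (simp add: left_module_def stage_simps(2))

lemma encode_linear:
  assumes X: "inverse_sequence R X"
  shows "(\<lambda>a\<in>carrier (stage X n). \<iota> a) \<in> linear_maps R (stage X n) (obj (filt X) n)"
  by (rule linear_mapsI)
     (simp_all add: filt_encode filt_add filt_smult stage_add_closed[OF X] stage_smult_closed[OF X] stage_simps(3,4))

lemma filt_free:
  assumes X: "inverse_sequence R X"
  shows "free_module R (obj (filt X) n)"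
proof -
  obtain S' and \<Phi> :: "_ \<Rightarrow> (nat \<Rightarrow> 'x) \<times> (nat \<Rightarrow> 'x \<Rightarrow> 'r) \<Rightarrow> 'r"
    where \<Phi>: "\<Phi> \<in> linear_isos R (free_on R (S' :: ((nat \<Rightarrow> 'x) \<times> (nat \<Rightarrow> 'x \<Rightarrow> 'r)) set)) (stage X n)"
    using stage_free[OF X, of n] by blast
  then have lin: "\<Phi> \<in> linear_maps R (free_on R S') (stage X n)"
    and bij: "bij_betw \<Phi> (carrier (free_on R S')) (carrier (stage X n))"
    by (simp_all add: linear_isos_def)
  let ?\<Psi> = "compose (carrier (free_on R S')) (\<lambda>a\<in>carrier (stage X n). \<iota> a) \<Phi>"
  have z: "(\<lambda>_. \<zero>) \<in> carrier (free_on R S')"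
    by (simp add: free_on_carrier)
  have "inj_on \<iota> (carrier (stage X n))"
    by (rule inj_on_inverseI[of _ decode]) (rule decode_stage)
  then have "bij_betw (\<lambda>a\<in>carrier (stage X n). \<iota> a) (carrier (stage X n)) (carrier (obj (filt X) n))"
    by (simp add: bij_betw_def filt_carrier inj_on_restrict_eq)
  then have "bij_betw ?\<Psi> (carrier (free_on R S')) (carrier (obj (filt X) n))"
    using bij by (rule bij_betw_compose[rotated])
  moreover have "?\<Psi> \<in> linear_maps R (free_on R S') (obj (filt X) n)"
    by (rule linear_maps_comp[OF encode_linear[OF X] lin free_on_left_module])
  ultimately have "?\<Psi> \<in> linear_isos R (free_on R S') (obj (filt X) n)"
    by (simp only: linear_isos_def mem_Collect_eq simp_thms)
  moreover have "?\<Psi> (\<lambda>_. \<zero>) = \<zero>\<^bsub>obj (filt X) n\<^esub>"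
    unfolding compose_eq[OF z] stage_iso_zero[OF \<Phi>] filt_zero
    by (rule restrict_apply'[OF stage_zero_closed[OF X]])
  ultimately show ?thesis
    by (rule free_moduleI[OF ring_axioms])
qed

lemma filt_left_module: "inverse_sequence R X \<Longrightarrow> left_module R (obj (filt X) n)"
  using filt_free[of X n] by (simp add: free_module_def)

lemma stage_Suc: "a \<in> carrier (stage X (Suc n)) \<Longrightarrow> a \<in> carrier (stage X n)"
  by (simp add: stage_simps)

lemma filt_Suc: "u \<in> carrier (obj (filt X) (Suc n)) \<Longrightarrow> u \<in> carrier (obj (filt X) n)"
  unfolding filt_carrier by (elim imageE) (simp add: stage_Suc)

lemma filt_inverse_sequence:
  assumes X: "inverse_sequence R X"
  shows "inverse_sequence R (filt X)"
proof -
  have "smap (filt X) (Suc n) \<in> linear_maps R (obj (filt X) (Suc n)) (obj (filt X) n)" for n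
  proof (rule linear_mapsI)
    fix u assume u: "u \<in> carrier (obj (filt X) (Suc n))"
    then obtain a where a: "a \<in> carrier (stage X (Suc n))" "u = \<iota> a"
      by (rule filt_cases)
    show "smap (filt X) (Suc n) u \<in> carrier (obj (filt X) n)"
      using filt_Suc[OF u] by (simp add: filt_smap[OF u])
    fix v assume v: "v \<in> carrier (obj (filt X) (Suc n))"
    then obtain b where b: "b \<in> carrier (stage X (Suc n))" "v = \<iota> b"
      by (rule filt_cases)
    show "smap (filt X) (Suc n) (u \<oplus>\<^bsub>obj (filt X) (Suc n)\<^esub> v) =
        smap (filt X) (Suc n) u \<oplus>\<^bsub>obj (filt X) n\<^esub> smap (filt X) (Suc n) v"
      unfolding filt_smap[OF u] filt_smap[OF v] unfolding a(2) b(2) filt_add[OF a(1) b(1)]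
        filt_add[OF stage_Suc[OF a(1)] stage_Suc[OF b(1)]]
      by (rule filt_smap[OF filt_encode[OF stage_add_closed[OF X a(1) b(1)]]])
  next
    fix c u assume c: "c \<in> carrier R" and u: "u \<in> carrier (obj (filt X) (Suc n))"
    then obtain a where a: "a \<in> carrier (stage X (Suc n))" "u = \<iota> a"
      by (blast elim: filt_cases)
    show "smap (filt X) (Suc n) (c \<odot>\<^bsub>obj (filt X) (Suc n)\<^esub> u) = c \<odot>\<^bsub>obj (filt X) n\<^esub> smap (filt X) (Suc n) u"
      unfolding filt_smap[OF u] unfolding a(2) filt_smult[OF a(1)] filt_smult[OF stage_Suc[OF a(1)]]
      by (rule filt_smap[OF filt_encode[OF stage_smult_closed[OF X c a(1)]]])
  next
    fix u assume "u \<notin> carrier (obj (filt X) (Suc n))"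
    then show "smap (filt X) (Suc n) u = undefined"
      by (simp add: filt_def)
  qed
  then have "smap (filt X) n \<in> linear_maps R (obj (filt X) n) (obj (filt X) (n - 1))" if "n \<ge> 1" for n
    using that by (cases n) auto
  then show ?thesis
    using filt_left_module[OF X] by (simp add: inverse_sequence_def)
qed

lemma decode_linear:
  assumes X: "inverse_sequence R X" and h: "h \<in> linear_maps R (free_on R (witnesses X)) N"
  shows "(\<lambda>u\<in>carrier (obj (filt X) n). h (decode u)) \<in> linear_maps R (obj (filt X) n) N" (is "?h \<in> _")
proof -
  have h_apply: "?h (\<iota> a) = h a" if "a \<in> carrier (stage X n)" for a
    using that by (simp add: filt_encode decode_stage)
  show ?thesis
  proof (rule linear_mapsI)
    fix u assume "u \<in> carrier (obj (filt X) n)"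
    then obtain a where a: "a \<in> carrier (stage X n)" "u = \<iota> a"
      by (rule filt_cases)
    show "?h u \<in> carrier N"
      unfolding a(2) h_apply[OF a(1)] by (rule linear_maps_closed[OF h stage_subset[OF a(1)]])
    fix v assume "v \<in> carrier (obj (filt X) n)"
    then obtain b where b: "b \<in> carrier (stage X n)" "v = \<iota> b"
      by (rule filt_cases)
    have "h (\<lambda>p. a p \<oplus> b p) = h a \<oplus>\<^bsub>N\<^esub> h b"
      using linear_maps_add[OF h stage_subset[OF a(1)] stage_subset[OF b(1)]] by simp
    then show "?h (u \<oplus>\<^bsub>obj (filt X) n\<^esub> v) = ?h u \<oplus>\<^bsub>N\<^esub> ?h v"
      unfolding a(2) b(2) filt_add[OF a(1) b(1)] h_apply[OF a(1)] h_apply[OF b(1)]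
        h_apply[OF stage_add_closed[OF X a(1) b(1)]] .
  next
    fix c u assume c: "c \<in> carrier R" and "u \<in> carrier (obj (filt X) n)"
    then obtain a where a: "a \<in> carrier (stage X n)" "u = \<iota> a"
      by (blast elim: filt_cases)
    have "h (\<lambda>p. c \<otimes> a p) = c \<odot>\<^bsub>N\<^esub> h a"
      using linear_maps_smult[OF h c stage_subset[OF a(1)]] by simp
    then show "?h (c \<odot>\<^bsub>obj (filt X) n\<^esub> u) = c \<odot>\<^bsub>N\<^esub> ?h u"
      unfolding a(2) filt_smult[OF a(1)] h_apply[OF a(1)] h_apply[OF stage_smult_closed[OF X c a(1)]] .
  qed simp
qed

lemma filt_quotient_free:
  assumes X: "inverse_sequence R X"
  shows "free_module R (successive_quotient (filt X) n)"
proof -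
  let ?L = "free_on R (carrier (obj X n))"
  let ?g = "\<lambda>u\<in>carrier (obj (filt X) n). defect X n (decode u)"
  let ?I = "smap (filt X) (Suc n) ` carrier (obj (filt X) (Suc n))"
  let ?\<Phi> = "\<lambda>w\<in>carrier ?L. {u \<in> carrier (obj (filt X) n). ?g u = w}"
  have g_apply: "?g (\<iota> a) = defect X n a" if "a \<in> carrier (stage X n)" for a
    using that by (simp add: filt_encode decode_stage)
  have "?I = (\<lambda>u. u) ` carrier (obj (filt X) (Suc n))"
    by (rule image_cong[OF refl]) (rule filt_smap)
  also have "\<dots> = {u \<in> carrier (obj (filt X) n). ?g u = \<zero>\<^bsub>?L\<^esub>}"
  proof (intro equalityI subsetI)
    fix u assume "u \<in> (\<lambda>u. u) ` carrier (obj (filt X) (Suc n))"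
    then obtain a where a: "a \<in> carrier (stage X (Suc n))" "u = \<iota> a"
      by (auto elim: filt_cases)
    have "?g u = \<zero>\<^bsub>?L\<^esub>"
      unfolding a(2) g_apply[OF stage_Suc[OF a(1)]] using a(1) by (simp add: stage_simps)
    then show "u \<in> {u \<in> carrier (obj (filt X) n). ?g u = \<zero>\<^bsub>?L\<^esub>}"
      using filt_encode[OF stage_Suc[OF a(1)]] a(2) by simp
  next
    fix u assume u: "u \<in> {u \<in> carrier (obj (filt X) n). ?g u = \<zero>\<^bsub>?L\<^esub>}"
    then obtain a where a: "a \<in> carrier (stage X n)" "u = \<iota> a"
      by (auto elim: filt_cases)
    have "defect X n a = (\<lambda>_. \<zero>)"
      using u unfolding a(2) mem_Collect_eq g_apply[OF a(1)] by simp
    then have "a \<in> carrier (stage X (Suc n))"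
      using a(1) by (simp add: stage_simps less_Suc_eq)
    then show "u \<in> (\<lambda>u. u) ` carrier (obj (filt X) (Suc n))"
      unfolding a(2) by (intro imageI filt_encode)
  qed
  finally have I: "?I = {u \<in> carrier (obj (filt X) n). ?g u = \<zero>\<^bsub>?L\<^esub>}" .
  have onto: "\<exists>u\<in>carrier (obj (filt X) n). ?g u = w" if "w \<in> carrier ?L" for w
  proof -
    obtain a where "a \<in> carrier (stage X n)" "defect X n a = w"
      using stage_defect_onto[OF X \<open>w \<in> carrier ?L\<close>] by blast
    then show ?thesis
      by (intro bexI[of _ "\<iota> a"]) (simp_all add: g_apply filt_encode del: restrict_apply)
  qed
  have "?\<Phi> \<in> linear_isos R ?L (quotient_module (obj (filt X) n) ?I)"
    by (rule fibre_map_iso[OF filt_left_module[OF X] free_on_left_module decode_linear[OF X defect_linear] onto I])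
  moreover have "?\<Phi> (\<lambda>_. \<zero>) = \<zero>\<^bsub>quotient_module (obj (filt X) n) ?I\<^esub>"
    unfolding quotient_module_simps I by (simp add: free_on_carrier)
  ultimately have "free_module R (quotient_module (obj (filt X) n) ?I)"
    by (rule free_moduleI[OF ring_axioms])
  then show ?thesis
    by (simp only: successive_quotient_def coker_def)
qed

lemma filt_hom_apply: "a \<in> carrier (stage X n) \<Longrightarrow> filt_hom X n (\<iota> a) = entry X n a"
  by (simp add: filt_hom_def filt_encode decode_stage)

lemma filt_hom_inv_seq_hom:
  assumes X: "inverse_sequence R X"
  shows "filt_hom X \<in> inv_seq_hom R (filt X) X"
proof -
  have "filt_hom X n \<in> linear_maps R (obj (filt X) n) (obj X n)" for n
    unfolding filt_hom_def by (rule decode_linear[OF X entry_linear[OF X]])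
  moreover have "filt_hom X (n - 1) (smap (filt X) n u) = smap X n (filt_hom X n u)"
    if n: "n \<ge> 1" and u: "u \<in> carrier (obj (filt X) n)" for n u
  proof -
    obtain m where m: "n = Suc m"
      using n by (cases n) auto
    obtain a where a: "a \<in> carrier (stage X n)" "u = \<iota> a"
      using u by (rule filt_cases)
    show ?thesis
      using stage_entry[OF X, of a m] a(1) unfolding filt_smap[OF u] unfolding a(2)
      by (simp add: m filt_hom_apply stage_Suc)
  qed
  ultimately show ?thesis
    by (simp add: inv_seq_hom_def)
qed

lemma filt_lim1:
  assumes X: "inverse_sequence R X"
  shows "lim1_map (filt X) X (filt_hom X) \<in> linear_isos R (lim1 (filt X)) (lim1 X)"
proof (rule lim1_map_isoI[OF filt_inverse_sequence[OF X] X filt_hom_inv_seq_hom[OF X]])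
  fix n x assume "x \<in> carrier (obj X n)"
  then obtain p where p: "p \<in> witnesses X" "fst p n = x" "snd p = (\<lambda>k. if k = n then gen R x else (\<lambda>_. \<zero>))"
    using ex_basic_witness[OF X] by blast
  then have a: "gen R p \<in> carrier (stage X n)"
    by (simp add: stage_simps gen_closed defect_gen)
  show "\<exists>u\<in>carrier (obj (filt X) n). filt_hom X n u = x"
    using p by (intro bexI[OF _ filt_encode[OF a]]) (simp add: filt_hom_apply[OF a] entry_gen[OF X])
next
  fix a y
  assume a: "\<And>n. a n \<in> carrier (obj (filt X) n)" and y: "\<And>n. y n \<in> carrier (obj X n)"
    and eq: "\<And>n. filt_hom X n (a n) = y n \<ominus>\<^bsub>obj X n\<^esub> smap X (Suc n) (y (Suc n))"
  have "\<forall>n. \<exists>c. c \<in> carrier (stage X n) \<and> a n = \<iota> c"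
    using a by (metis filt_cases)
  then obtain \<alpha> where \<alpha>: "\<And>n. \<alpha> n \<in> carrier (stage X n)" "\<And>n. a n = \<iota> (\<alpha> n)"
    by (metis (no_types))
  have "entry X n (\<alpha> n) = y n \<ominus>\<^bsub>obj X n\<^esub> smap X (Suc n) (y (Suc n))" for n
    using eq[of n] by (simp only: \<alpha>(2) filt_hom_apply[OF \<alpha>(1)])
  from stage_shift_onto[OF X \<alpha>(1) y this]
  obtain u where u: "\<And>n. u n \<in> carrier (stage X n)" "\<And>n. u n = (\<lambda>s. \<alpha> n s \<oplus> u (Suc n) s)"
    by blast
  have "a n = \<iota> (u n) \<ominus>\<^bsub>obj (filt X) n\<^esub> smap (filt X) (Suc n) (\<iota> (u (Suc n)))" for n
  proof -
    interpret A: left_module R "obj (filt X) n"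
      by (rule filt_left_module[OF X])
    have "\<iota> (u n) = a n \<oplus>\<^bsub>obj (filt X) n\<^esub> \<iota> (u (Suc n))"
      unfolding \<alpha>(2) filt_add[OF \<alpha>(1) stage_Suc[OF u(1)]] by (rule arg_cong[OF u(2)])
    moreover have "\<iota> (u (Suc n)) \<in> carrier (obj (filt X) n)"
      by (rule filt_encode[OF stage_Suc[OF u(1)]])
    ultimately show ?thesis
      unfolding filt_smap[OF filt_encode[OF u(1)]]
      using a[of n] by (simp add: a_minus_def A.M.a_assoc A.M.r_neg)
  qed
  then show "\<exists>u. \<forall>n. u n \<in> carrier (obj (filt X) n) \<and>
      a n = u n \<ominus>\<^bsub>obj (filt X) n\<^esub> smap (filt X) (Suc n) (u (Suc n))"
    using filt_encode[OF u(1)] by (intro exI[of _ "\<lambda>n. \<iota> (u n)"]) simp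
qed

end

section \<open>Functoriality\<close>

context ring
begin

lemma hom_in_funcset: "h \<in> inv_seq_hom R X Y \<Longrightarrow> h k \<in> carrier (obj X k) \<rightarrow> carrier (obj Y k)"
  by (rule Pi_I) (rule linear_maps_closed[OF inv_seq_hom_linear])

lemma realize_natural:
  assumes X: "inverse_sequence R X" and Y: "inverse_sequence R Y" and h: "h \<in> inv_seq_hom R X Y"
    and b: "b \<in> carrier (free_on R (carrier (obj X k)))"
  shows "realize Y k (free_map (carrier (obj X k)) (carrier (obj Y k)) (h k) b) = h k (realize X k b)"
proof (rule comp_agree[OF free_map_linear[OF hom_in_funcset[OF h]] realize_linear[OF Y]
      realize_linear[OF X] inv_seq_hom_linear[OF h] inverse_sequence_obj[OF Y] _ b])
  fix x assume x: "x \<in> carrier (obj X k)"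
  show "realize Y k (free_map (carrier (obj X k)) (carrier (obj Y k)) (h k) (gen R x)) =
      h k (realize X k (gen R x))"
    unfolding free_map_gen[OF hom_in_funcset[OF h] x] realize_gen[OF X x]
    by (rule realize_gen[OF Y linear_maps_closed[OF inv_seq_hom_linear[OF h] x]])
qed

lemma witness_map_closed:
  assumes X: "inverse_sequence R X" and Y: "inverse_sequence R Y" and h: "h \<in> inv_seq_hom R X Y"
  shows "witness_map X Y h \<in> witnesses X \<rightarrow> witnesses Y"
proof (rule Pi_I)
  fix p assume "p \<in> witnesses X"
  then obtain y b where p: "p = (y, b)" and y: "\<And>k. y k \<in> carrier (obj X k)"
    and b: "\<And>k. b k \<in> carrier (free_on R (carrier (obj X k)))"
    and eq: "\<And>k. y k \<ominus>\<^bsub>obj X k\<^esub> smap X (Suc k) (y (Suc k)) = realize X k (b k)"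
    by (cases p) (simp add: witnesses_def)
  note hl = inv_seq_hom_linear[OF h]
  have "h k (y k) \<ominus>\<^bsub>obj Y k\<^esub> smap Y (Suc k) (h (Suc k) (y (Suc k))) =
      realize Y k (free_map (carrier (obj X k)) (carrier (obj Y k)) (h k) (b k))" for k
    unfolding realize_natural[OF X Y h b] eq[symmetric] inv_seq_hom_smap[OF h y, symmetric]
    by (rule linear_maps_diff[OF hl inverse_sequence_obj[OF X] inverse_sequence_obj[OF Y] y
          linear_maps_closed[OF inverse_sequence_smap[OF X] y], symmetric])
  then show "witness_map X Y h p \<in> witnesses Y"
    by (simp add: p witness_map_def witnesses_def linear_maps_closed[OF hl y]
        linear_maps_closed[OF free_map_linear[OF hom_in_funcset[OF h]] b])
qed

abbreviation (input) free_witness_map where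
  "free_witness_map X Y h \<equiv> free_map (witnesses X) (witnesses Y) (witness_map X Y h)"

lemma defect_natural:
  assumes X: "inverse_sequence R X" and Y: "inverse_sequence R Y" and h: "h \<in> inv_seq_hom R X Y"
    and a: "a \<in> carrier (free_on R (witnesses X))"
  shows "defect Y k (free_witness_map X Y h a) =
    free_map (carrier (obj X k)) (carrier (obj Y k)) (h k) (defect X k a)"
proof (rule comp_agree[OF free_map_linear[OF witness_map_closed[OF X Y h]] defect_linear
      defect_linear free_map_linear[OF hom_in_funcset[OF h]] free_on_left_module _ a])
  fix p assume p: "p \<in> witnesses X"
  show "defect Y k (free_witness_map X Y h (gen R p)) =
    free_map (carrier (obj X k)) (carrier (obj Y k)) (h k) (defect X k (gen R p))"
    unfolding free_map_gen[OF witness_map_closed[OF X Y h] p] defect_gen[OF p]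
      defect_gen[OF funcset_mem[OF witness_map_closed[OF X Y h] p]]
    by (simp add: witness_map_def)
qed

lemma entry_natural:
  assumes X: "inverse_sequence R X" and Y: "inverse_sequence R Y" and h: "h \<in> inv_seq_hom R X Y"
    and a: "a \<in> carrier (free_on R (witnesses X))"
  shows "entry Y k (free_witness_map X Y h a) = h k (entry X k a)"
proof (rule comp_agree[OF free_map_linear[OF witness_map_closed[OF X Y h]] entry_linear[OF Y]
      entry_linear[OF X] inv_seq_hom_linear[OF h] inverse_sequence_obj[OF Y] _ a])
  fix p assume p: "p \<in> witnesses X"
  show "entry Y k (free_witness_map X Y h (gen R p)) = h k (entry X k (gen R p))"
    unfolding free_map_gen[OF witness_map_closed[OF X Y h] p] entry_gen[OF X p]
      entry_gen[OF Y funcset_mem[OF witness_map_closed[OF X Y h] p]]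
    by (simp add: witness_map_def)
qed

lemma free_witness_map_stage:
  assumes X: "inverse_sequence R X" and Y: "inverse_sequence R Y" and h: "h \<in> inv_seq_hom R X Y"
    and a: "a \<in> carrier (stage X n)"
  shows "free_witness_map X Y h a \<in> carrier (stage Y n)"
proof -
  have zero: "free_map (carrier (obj X k)) (carrier (obj Y k)) (h k) (\<lambda>_. \<zero>) = (\<lambda>_. \<zero>)" for k
    using linear_maps_zero[OF free_map_linear[OF hom_in_funcset[OF h]] free_on_left_module free_on_left_module]
    by simp
  have "defect Y k (free_witness_map X Y h a) = (\<lambda>_. \<zero>)" if "k < n" for k
    unfolding defect_natural[OF X Y h stage_subset[OF a]] using a that by (simp add: stage_simps zero)
  then show ?thesis
    using linear_maps_closed[OF free_map_linear[OF witness_map_closed[OF X Y h]] stage_subset[OF a]]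
    by (simp add: stage_simps)
qed

lemma witness_map_id:
  assumes p: "p \<in> witnesses X"
  shows "witness_map X X (inv_seq_id X) p = p"
proof -
  obtain y b where yb: "p = (y, b)" "\<And>k. y k \<in> carrier (obj X k)"
    "\<And>k. b k \<in> carrier (free_on R (carrier (obj X k)))"
    using p by (cases p) (simp add: witnesses_def)
  have "free_map (carrier (obj X k)) (carrier (obj X k)) (inv_seq_id X k) (b k) = b k" for k
    by (rule free_map_id[OF _ yb(3)]) (simp add: inv_seq_id_def)
  then show ?thesis
    using yb(2) by (simp add: yb(1) witness_map_def inv_seq_id_def)
qed

lemma witness_map_comp:
  assumes f: "f \<in> inv_seq_hom R X Y" and g: "g \<in> inv_seq_hom R Y Z" and p: "p \<in> witnesses X"
  shows "witness_map X Z (inv_seq_comp X g f) p = witness_map Y Z g (witness_map X Y f p)"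
proof -
  obtain y b where yb: "p = (y, b)" "\<And>k. y k \<in> carrier (obj X k)"
    "\<And>k. b k \<in> carrier (free_on R (carrier (obj X k)))"
    using p by (cases p) (simp add: witnesses_def)
  have "free_map (carrier (obj X k)) (carrier (obj Z k)) (inv_seq_comp X g f k) (b k) =
      free_map (carrier (obj Y k)) (carrier (obj Z k)) (g k)
        (free_map (carrier (obj X k)) (carrier (obj Y k)) (f k) (b k))" for k
    by (rule free_map_comp[OF hom_in_funcset[OF f] hom_in_funcset[OF g] _ yb(3)])
       (simp add: inv_seq_comp_def compose_eq)
  then show ?thesis
    using yb(2) by (simp add: yb(1) witness_map_def inv_seq_comp_def compose_eq)
qed

end

context filtration_encoding
begin

lemma filt_map_apply:
  "a \<in> carrier (stage X n) \<Longrightarrow> filt_map X Y h n (\<iota> a) = \<iota> (free_witness_map X Y h a)"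
  by (simp add: filt_map_def filt_encode decode_stage)

lemma filt_map_hom:
  assumes X: "inverse_sequence R X" and Y: "inverse_sequence R Y" and h: "h \<in> inv_seq_hom R X Y"
  shows "filt_map X Y h \<in> inv_seq_hom R (filt X) (filt Y)"
proof -
  note lin = free_map_linear[OF witness_map_closed[OF X Y h]]
  have cl: "filt_map X Y h n u \<in> carrier (obj (filt Y) n)" if "u \<in> carrier (obj (filt X) n)" for n u
  proof -
    obtain a where a: "a \<in> carrier (stage X n)" "u = \<iota> a"
      using \<open>u \<in> _\<close> by (rule filt_cases)
    show ?thesis
      unfolding a(2) filt_map_apply[OF a(1)] by (rule filt_encode[OF free_witness_map_stage[OF X Y h a(1)]])
  qed
  have "filt_map X Y h n \<in> linear_maps R (obj (filt X) n) (obj (filt Y) n)" for n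
  proof (rule linear_mapsI)
    fix u assume u: "u \<in> carrier (obj (filt X) n)"
    then show "filt_map X Y h n u \<in> carrier (obj (filt Y) n)"
      by (rule cl)
    obtain a where a: "a \<in> carrier (stage X n)" "u = \<iota> a"
      using u by (rule filt_cases)
    fix v assume v: "v \<in> carrier (obj (filt X) n)"
    obtain b where b: "b \<in> carrier (stage X n)" "v = \<iota> b"
      using v by (rule filt_cases)
    have "free_witness_map X Y h (\<lambda>p. a p \<oplus> b p) =
        (\<lambda>p. free_witness_map X Y h a p \<oplus> free_witness_map X Y h b p)"
      using linear_maps_add[OF lin stage_subset[OF a(1)] stage_subset[OF b(1)]] by simp
    then show "filt_map X Y h n (u \<oplus>\<^bsub>obj (filt X) n\<^esub> v) =
        filt_map X Y h n u \<oplus>\<^bsub>obj (filt Y) n\<^esub> filt_map X Y h n v"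
      unfolding a(2) b(2) filt_add[OF a(1) b(1)] filt_map_apply[OF a(1)] filt_map_apply[OF b(1)]
        filt_map_apply[OF stage_add_closed[OF X a(1) b(1)]]
        filt_add[OF free_witness_map_stage[OF X Y h a(1)] free_witness_map_stage[OF X Y h b(1)]]
      by (rule arg_cong)
  next
    fix c u assume c: "c \<in> carrier R" and u: "u \<in> carrier (obj (filt X) n)"
    obtain a where a: "a \<in> carrier (stage X n)" "u = \<iota> a"
      using u by (rule filt_cases)
    have "free_witness_map X Y h (\<lambda>p. c \<otimes> a p) = (\<lambda>p. c \<otimes> free_witness_map X Y h a p)"
      using linear_maps_smult[OF lin c stage_subset[OF a(1)]] by simp
    then show "filt_map X Y h n (c \<odot>\<^bsub>obj (filt X) n\<^esub> u) = c \<odot>\<^bsub>obj (filt Y) n\<^esub> filt_map X Y h n u"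
      unfolding a(2) filt_smult[OF a(1)] filt_map_apply[OF a(1)]
        filt_map_apply[OF stage_smult_closed[OF X c a(1)]] filt_smult[OF free_witness_map_stage[OF X Y h a(1)]]
      by (rule arg_cong)
  qed (simp add: filt_map_def)
  moreover have "filt_map X Y h (n - 1) (smap (filt X) n u) = smap (filt Y) n (filt_map X Y h n u)"
    if n: "n \<ge> 1" and u: "u \<in> carrier (obj (filt X) n)" for n u
  proof -
    obtain m where m: "n = Suc m"
      using n by (cases n) auto
    obtain a where a: "a \<in> carrier (stage X n)" "u = \<iota> a"
      using u by (rule filt_cases)
    show ?thesis
      unfolding filt_smap[OF u] filt_smap[OF cl[OF u]] unfolding a(2) filt_map_apply[OF a(1)]
      using a(1) by (simp add: m filt_map_apply stage_Suc)
  qed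
  ultimately show ?thesis
    by (simp add: inv_seq_hom_def)
qed

lemma filt_map_id:
  assumes X: "inverse_sequence R X"
  shows "filt_map X X (inv_seq_id X) = inv_seq_id (filt X)"
proof (rule ext, rule ext)
  fix n u
  show "filt_map X X (inv_seq_id X) n u = inv_seq_id (filt X) n u"
  proof (cases "u \<in> carrier (obj (filt X) n)")
    case True
    obtain a where a: "a \<in> carrier (stage X n)" "u = \<iota> a"
      using True by (rule filt_cases)
    have "free_witness_map X X (inv_seq_id X) a = a"
      by (rule free_map_id[OF witness_map_id stage_subset[OF a(1)]])
    then show ?thesis
      unfolding a(2) filt_map_apply[OF a(1)] by (simp add: inv_seq_id_def filt_encode[OF a(1)])
  next
    case False
    then show ?thesis
      by (simp add: filt_map_def inv_seq_id_def)
  qed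
qed

lemma filt_map_comp:
  assumes X: "inverse_sequence R X" and Y: "inverse_sequence R Y" and Z: "inverse_sequence R Z"
    and f: "f \<in> inv_seq_hom R X Y" and g: "g \<in> inv_seq_hom R Y Z"
  shows "filt_map X Z (inv_seq_comp X g f) = inv_seq_comp (filt X) (filt_map Y Z g) (filt_map X Y f)"
proof (rule ext, rule ext)
  fix n u
  show "filt_map X Z (inv_seq_comp X g f) n u = inv_seq_comp (filt X) (filt_map Y Z g) (filt_map X Y f) n u"
  proof (cases "u \<in> carrier (obj (filt X) n)")
    case True
    obtain a where a: "a \<in> carrier (stage X n)" "u = \<iota> a"
      using True by (rule filt_cases)
    have "free_witness_map X Z (inv_seq_comp X g f) a = free_witness_map Y Z g (free_witness_map X Y f a)"
      by (rule free_map_comp[OF witness_map_closed[OF X Y f] witness_map_closed[OF Y Z g]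
            witness_map_comp[OF f g] stage_subset[OF a(1)]])
    then show ?thesis
      unfolding inv_seq_comp_def compose_eq[OF True]
      unfolding a(2) filt_map_apply[OF a(1)] filt_map_apply[OF free_witness_map_stage[OF X Y f a(1)]]
      by (simp add: inv_seq_comp_def)
  next
    case False
    then show ?thesis
      by (simp add: filt_map_def inv_seq_comp_def compose_def)
  qed
qed

lemma filt_hom_natural:
  assumes X: "inverse_sequence R X" and Y: "inverse_sequence R Y" and h: "h \<in> inv_seq_hom R X Y"
  shows "inv_seq_comp (filt X) (filt_hom Y) (filt_map X Y h) = inv_seq_comp (filt X) h (filt_hom X)"
proof (rule ext, rule ext)
  fix n u
  show "inv_seq_comp (filt X) (filt_hom Y) (filt_map X Y h) n u = inv_seq_comp (filt X) h (filt_hom X) n u"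
  proof (cases "u \<in> carrier (obj (filt X) n)")
    case True
    obtain a where a: "a \<in> carrier (stage X n)" "u = \<iota> a"
      using True by (rule filt_cases)
    show ?thesis
      unfolding inv_seq_comp_def compose_eq[OF True]
      unfolding a(2) filt_map_apply[OF a(1)] filt_hom_apply[OF a(1)]
        filt_hom_apply[OF free_witness_map_stage[OF X Y h a(1)]]
      by (rule entry_natural[OF X Y h stage_subset[OF a(1)]])
  next
    case False
    then show ?thesis
      by (simp add: inv_seq_comp_def compose_def)
  qed
qed

lemma filt_functor: "is_inv_seq_functor R filt filt_map"
  unfolding is_inv_seq_functor_def
  using filt_inverse_sequence filt_map_hom filt_map_id filt_map_comp by (intro conjI allI impI)

lemma filt_natural: "is_natural_to_identity R filt filt_map filt_hom"
  unfolding is_natural_to_identity_def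
  using filt_hom_inv_seq_hom filt_hom_natural by (intro conjI allI impI)

lemma filt_represents_filtration: "represents_filtration (filt X)"
  unfolding represents_filtration_def by (auto intro!: inj_onI simp: filt_smap)

end

theorem mainTheorem1:
  fixes R :: "('r, 'k) ring_scheme"
  assumes "ring R"
    and "\<exists>e :: (nat \<Rightarrow> 'x + 'r) \<Rightarrow> 'y. inj e"
  shows "\<exists>(A :: ('r, 'x) inv_seq \<Rightarrow> ('r, 'y) inv_seq)
            (A\<^sub>m :: ('r, 'x) inv_seq \<Rightarrow> ('r, 'x) inv_seq \<Rightarrow> (nat \<Rightarrow> 'x \<Rightarrow> 'x) \<Rightarrow> (nat \<Rightarrow> 'y \<Rightarrow> 'y))
            (f :: ('r, 'x) inv_seq \<Rightarrow> nat \<Rightarrow> 'y \<Rightarrow> 'x).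
           is_inv_seq_functor R A A\<^sub>m \<and>
           is_natural_to_identity R A A\<^sub>m f \<and>
           (\<forall>X. inverse_sequence R X \<longrightarrow>
              represents_filtration (A X) \<and>
              (\<forall>n. free_module R (obj (A X) n)) \<and>
              (\<forall>n. free_module R (successive_quotient (A X) n)) \<and>
              lim1_map (A X) X (f X) \<in> linear_isos R (lim1 (A X)) (lim1 X))"
proof -
  obtain e :: "(nat \<Rightarrow> 'x + 'r) \<Rightarrow> 'y" where e: "inj e"
    using assms(2) by blast
  obtain d :: "((nat \<Rightarrow> 'x) \<times> (nat \<Rightarrow> 'x \<Rightarrow> 'r) \<Rightarrow> 'r) \<Rightarrow> nat \<Rightarrow> 'x + 'r"
    where d: "inj_on d (nested_finite_support \<zero>\<^bsub>R\<^esub>)"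
    using encode_generators[of "\<zero>\<^bsub>R\<^esub>"] by blast
  interpret ring R
    by fact
  interpret filtration_encoding R "\<lambda>g. e (d g)"
  proof
    show "inj_on (\<lambda>g. e (d g)) (nested_finite_support \<zero>\<^bsub>R\<^esub>)"
      using comp_inj_on[OF d inj_on_subset[OF e subset_UNIV]] by (simp add: comp_def)
  qed
  show ?thesis
    using filt_functor filt_natural filt_represents_filtration filt_free filt_quotient_free filt_lim1
    by (intro exI[of _ filt] exI[of _ filt_map] exI[of _ filt_hom] conjI allI impI)
qed

end
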